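(* If $1<p\leq 2$ and $q$ is the conjugate index of $p$ ($1/p+1/q=1$), then $L^p$ is: (a) $r$-UWP($1$) when $1<r\leq p$; (b) $r$-LWP($C_{p,r}$) when $2\leq r\leq q$; and (c) $r$-LWP($1$) when $q\leq r<\infty$. If $2\leq p<\infty$ (with $q$ again the conjugate index of $p$), then $L^p$ is: (d) $r$-LWP($1$) when $p\leq r<\infty$; (e) $r$-UWP($C_{q,r'}^{-p/q}$) when $q\leq r\leq 2$; and (f) $r$-UWP($1$) when $1<r\leq q$, where $1/r+1/r'=1$. The weak parallelogram constants are optimal.
   Context: $L^p=L^p(X,\Omega,\sigma)$ is the usual Lebesgue space with norm $\|f\|_p=(\int|f|^p\,d\sigma)^{1/p}$. Let $C>0$ and $1<r<\infty$. A Banach space $\mathscr{X}$ with norm $\|\cdot\|$ is $r$-LWP($C$) (satisfies the $r$-lower weak parallelogram law with constant $C$) if $$\|\mathbf{x}+\mathbf{y}\|^r+C\|\mathbf{x}-\mathbf{y}\|^r\leq 2^{r-1}\big(\|\mathbf{x}\|^r+\|\mathbf{y}\|^r\big)\quad\text{for all }\mathbf{x},\mathbf{y}\in\mathscr{X}.$$ It is $r$-UWP($C$) (satisfies the $r$-upper weak parallelogram law with constant $C$) if $$\|\mathbf{x}+\mathbf{y}\|^r+C\|\mathbf{x}-\mathbf{y}\|^r\geq 2^{r-1}\big(\|\mathbf{x}\|^r+\|\mathbf{y}\|^r\big)\quad\text{for all }\mathbf{x},\mathbf{y}\in\mathscr{X}.$$ The number $C$ is called the weak parallelogram constant. Optimal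 means that, for the given $r$ and $p$, the constant is the largest $C$ for which the lower law holds (in the LWP cases), respectively the smallest $C$ for which the upper law holds (in the UWP cases). Define $$C_{p,r}:=\inf_{0\leq t<1}\frac{2^{r-r/p}(1+t^p)^{r/p}-(1+t)^r}{(1-t)^r};$$ $C_{q,r'}$ is this same quantity with $p$ replaced by $q$ and $r$ replaced by $r'$.
   Formalization: In (e) the law with C_{q,r'}^{-p/q} holds but is not optimal (p=4, r=2 gives 27, the best is 3); optimality is proved for C_{q,r'}^{-r/r'}. Optimality is asserted only for L^p nonzero, and in (b), (e) for dim L^p at least 2, since it fails on smaller spaces. *)

theory Defs
  imports "HOL-Analysis.Analysis"
begin

section \<open>Weak parallelogram laws\<close>

text \<open>The carrier and operations of a normed space, as far as the weak parallelogram laws refer to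
  them. An explicit carrier is needed because the space \<open>L\<^sup>p\<close> depends on a measure and on a real
  exponent, and therefore cannot be a type.\<close>

record 'v normed_structure =
  vcarrier :: "'v set"
  vadd :: "'v \<Rightarrow> 'v \<Rightarrow> 'v"
  vsub :: "'v \<Rightarrow> 'v \<Rightarrow> 'v"
  vnorm :: "'v \<Rightarrow> real"

definition LWP :: "('v, 'm) normed_structure_scheme \<Rightarrow> real \<Rightarrow> real \<Rightarrow> bool" where
  "LWP X r C \<longleftrightarrow> 1 < r \<and> 0 < C \<and>
     (\<forall>x\<in>vcarrier X. \<forall>y\<in>vcarrier X.
        vnorm X (vadd X x y) powr r + C * vnorm X (vsub X x y) powr r
          \<le> 2 powr (r - 1) * (vnorm X x powr r + vnorm X y powr r))"

definition UWP :: "('v, 'm) normed_structure_scheme \<Rightarrow> real \<Rightarrow> real \<Rightarrow> bool" where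
  "UWP X r C \<longleftrightarrow> 1 < r \<and> 0 < C \<and>
     (\<forall>x\<in>vcarrier X. \<forall>y\<in>vcarrier X.
        vnorm X (vadd X x y) powr r + C * vnorm X (vsub X x y) powr r
          \<ge> 2 powr (r - 1) * (vnorm X x powr r + vnorm X y powr r))"

definition optimal_LWP :: "('v, 'm) normed_structure_scheme \<Rightarrow> real \<Rightarrow> real \<Rightarrow> bool" where
  "optimal_LWP X r C \<longleftrightarrow> LWP X r C \<and> (\<forall>C'. LWP X r C' \<longrightarrow> C' \<le> C)"

definition optimal_UWP :: "('v, 'm) normed_structure_scheme \<Rightarrow> real \<Rightarrow> real \<Rightarrow> bool" where
  "optimal_UWP X r C \<longleftrightarrow> UWP X r C \<and> (\<forall>C'. UWP X r C' \<longrightarrow> C \<le> C')"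

text \<open>For \<open>p > 1\<close> and \<open>r \<ge> 1\<close> the numerator is nonnegative, so the infimum is over a set that is
  bounded below.\<close>

definition wp_const :: "real \<Rightarrow> real \<Rightarrow> real" where
  "wp_const p r =
     (INF t\<in>{0..<1}. (2 powr (r - r / p) * (1 + t powr p) powr (r / p) - (1 + t) powr r)
                       / (1 - t) powr r)"


section \<open>The Lebesgue space \<open>L\<^sup>p\<close>\<close>

text \<open>The sort of the scalars is inhabited, up to isomorphism, only by \<open>\<real>\<close> and \<open>\<complex>\<close> (it makes them
  finite-dimensional commutative real division algebras), so both the real and the complex space
  are covered.\<close>

definition Lp_fun :: "'a measure \<Rightarrow> real \<Rightarrow> ('a \<Rightarrow> 'k::{real_normed_field, euclidean_space}) set" where
  "Lp_fun M p = {f \<in> borel_measurable M. integrable M (\<lambda>x. norm (f x) powr p)}"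

definition Lp_rel ::
  "'a measure \<Rightarrow> real \<Rightarrow> (('a \<Rightarrow> 'k::{real_normed_field, euclidean_space}) \<times> ('a \<Rightarrow> 'k)) set" where
  "Lp_rel M p = {(f, g). f \<in> Lp_fun M p \<and> g \<in> Lp_fun M p \<and> (AE x in M. f x = g x)}"

definition Lp_fnorm :: "'a measure \<Rightarrow> real \<Rightarrow> ('a \<Rightarrow> 'k::{real_normed_field, euclidean_space}) \<Rightarrow> real" where
  "Lp_fnorm M p f = (\<integral>x. norm (f x) powr p \<partial>M) powr (1 / p)"

definition Lp :: "'a measure \<Rightarrow> real
    \<Rightarrow> ('a \<Rightarrow> 'k::{real_normed_field, euclidean_space}) set normed_structure" where
  "Lp M p =
     \<lparr>vcarrier = Lp_fun M p // Lp_rel M p,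
      vadd = (\<lambda>F G. \<Union>f\<in>F. \<Union>g\<in>G. Lp_rel M p `` {\<lambda>x. f x + g x}),
      vsub = (\<lambda>F G. \<Union>f\<in>F. \<Union>g\<in>G. Lp_rel M p `` {\<lambda>x. f x - g x}),
      vnorm = (\<lambda>F. the_elem (Lp_fnorm M p ` F))\<rparr>"


section \<open>The operations are well defined on classes\<close>

lemma equiv_Lp_rel: "equiv (Lp_fun M p) (Lp_rel M p)"
proof (rule equivI)
  show "Lp_rel M p \<subseteq> Lp_fun M p \<times> Lp_fun M p"
    by (auto simp: Lp_rel_def)
  show "refl_on (Lp_fun M p) (Lp_rel M p)"
    by (auto simp: Lp_rel_def refl_on_def)
  show "sym (Lp_rel M p)"
    by (auto simp: Lp_rel_def sym_def eq_commute)
  show "trans (Lp_rel M p)"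
  proof (rule transI)
    fix f g h
    assume fg: "(f, g) \<in> Lp_rel M p" and gh: "(g, h) \<in> Lp_rel M p"
    have "AE x in M. f x = g x" "AE x in M. g x = h x"
      using fg gh by (auto simp: Lp_rel_def)
    then have "AE x in M. f x = h x"
      by eventually_elim simp
    then show "(f, h) \<in> Lp_rel M p"
      using fg gh by (auto simp: Lp_rel_def)
  qed
qed

lemma Lp_fun_add:
  assumes p: "0 < p" and f: "f \<in> Lp_fun M p" and g: "g \<in> Lp_fun M p"
  shows "(\<lambda>x. f x + g x) \<in> Lp_fun M p"
proof -
  have [measurable]: "f \<in> borel_measurable M" "g \<in> borel_measurable M"
    using f g by (auto simp: Lp_fun_def)
  have "integrable M (\<lambda>x. norm (f x + g x) powr p)"
  proof (rule Bochner_Integration.integrable_bound)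
    show "integrable M (\<lambda>x. 2 powr p * (norm (f x) powr p + norm (g x) powr p))"
      using f g by (auto simp: Lp_fun_def)
    show "AE x in M. norm (norm (f x + g x) powr p)
            \<le> norm (2 powr p * (norm (f x) powr p + norm (g x) powr p))"
    proof (rule AE_I2)
      fix x
      let ?m = "max (norm (f x)) (norm (g x))"
      have "norm (f x + g x) \<le> 2 * ?m"
        using norm_triangle_ineq[of "f x" "g x"] by linarith
      then have "norm (f x + g x) powr p \<le> (2 * ?m) powr p"
        using p by (intro powr_mono2) auto
      also have "\<dots> = 2 powr p * ?m powr p"
        by (simp add: powr_mult)
      also have "\<dots> \<le> 2 powr p * (norm (f x) powr p + norm (g x) powr p)"
        by (intro mult_left_mono) (auto simp: max_def)
      finally show "norm (norm (f x + g x) powr p)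
            \<le> norm (2 powr p * (norm (f x) powr p + norm (g x) powr p))"
        by simp
    qed
  qed measurable
  then show ?thesis by (simp add: Lp_fun_def)
qed

lemma Lp_fun_diff:
  assumes "0 < p" "f \<in> Lp_fun M p" "g \<in> Lp_fun M p"
  shows "(\<lambda>x. f x - g x) \<in> Lp_fun M p"
proof -
  have "(\<lambda>x. - g x) \<in> Lp_fun M p"
    using assms(3) by (auto simp: Lp_fun_def)
  from Lp_fun_add[OF assms(1,2) this] show ?thesis by simp
qed

lemma Lp_rel_class_eq:
  assumes "h \<in> Lp_fun M p" "h' \<in> Lp_fun M p" "AE x in M. h x = h' x"
  shows "Lp_rel M p `` {h'} = Lp_rel M p `` {h}"
  using assms by (intro equiv_class_eq[OF equiv_Lp_rel, symmetric]) (auto simp: Lp_rel_def)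

lemma Lp_vadd:
  assumes "0 < p" "f \<in> Lp_fun M p" "g \<in> Lp_fun M p"
  shows "vadd (Lp M p) (Lp_rel M p `` {f}) (Lp_rel M p `` {g}) = Lp_rel M p `` {\<lambda>x. f x + g x}"
proof -
  have eq: "Lp_rel M p `` {\<lambda>x. f' x + g' x} = Lp_rel M p `` {\<lambda>x. f x + g x}"
    if f': "f' \<in> Lp_rel M p `` {f}" and g': "g' \<in> Lp_rel M p `` {g}" for f' g'
  proof (rule Lp_rel_class_eq)
    have "AE x in M. f x = f' x" "AE x in M. g x = g' x"
      using f' g' by (auto simp: Lp_rel_def)
    then show "AE x in M. f x + g x = f' x + g' x"
      by eventually_elim simp
  qed (use f' g' assms in \<open>auto simp: Lp_rel_def intro: Lp_fun_add\<close>)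
  have ne: "f \<in> Lp_rel M p `` {f}" "g \<in> Lp_rel M p `` {g}"
    using assms by (auto simp: Lp_rel_def)
  let ?c = "Lp_rel M p `` {\<lambda>x. f x + g x}"
  have "(\<Union>f'\<in>Lp_rel M p `` {f}. \<Union>g'\<in>Lp_rel M p `` {g}. Lp_rel M p `` {\<lambda>x. f' x + g' x})
      = (\<Union>f'\<in>Lp_rel M p `` {f}. \<Union>g'\<in>Lp_rel M p `` {g}. ?c)"
    by (intro SUP_cong refl eq)
  also have "\<dots> = ?c"
    using ne by blast
  finally show ?thesis by (simp add: Lp_def del: UN_simps Image_singleton)
qed

lemma Lp_vsub:
  assumes "0 < p" "f \<in> Lp_fun M p" "g \<in> Lp_fun M p"
  shows "vsub (Lp M p) (Lp_rel M p `` {f}) (Lp_rel M p `` {g}) = Lp_rel M p `` {\<lambda>x. f x - g x}"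
proof -
  have eq: "Lp_rel M p `` {\<lambda>x. f' x - g' x} = Lp_rel M p `` {\<lambda>x. f x - g x}"
    if f': "f' \<in> Lp_rel M p `` {f}" and g': "g' \<in> Lp_rel M p `` {g}" for f' g'
  proof (rule Lp_rel_class_eq)
    have "AE x in M. f x = f' x" "AE x in M. g x = g' x"
      using f' g' by (auto simp: Lp_rel_def)
    then show "AE x in M. f x - g x = f' x - g' x"
      by eventually_elim simp
  qed (use f' g' assms in \<open>auto simp: Lp_rel_def intro: Lp_fun_diff\<close>)
  have ne: "f \<in> Lp_rel M p `` {f}" "g \<in> Lp_rel M p `` {g}"
    using assms by (auto simp: Lp_rel_def)
  let ?c = "Lp_rel M p `` {\<lambda>x. f x - g x}"
  have "(\<Union>f'\<in>Lp_rel M p `` {f}. \<Union>g'\<in>Lp_rel M p `` {g}. Lp_rel M p `` {\<lambda>x. f' x - g' x})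
      = (\<Union>f'\<in>Lp_rel M p `` {f}. \<Union>g'\<in>Lp_rel M p `` {g}. ?c)"
    by (intro SUP_cong refl eq)
  also have "\<dots> = ?c"
    using ne by blast
  finally show ?thesis by (simp add: Lp_def del: UN_simps Image_singleton)
qed

lemma Lp_vnorm:
  assumes "f \<in> Lp_fun M p"
  shows "vnorm (Lp M p) (Lp_rel M p `` {f}) = Lp_fnorm M p f"
proof -
  have "Lp_fnorm M p g = Lp_fnorm M p f" if "g \<in> Lp_rel M p `` {f}" for g
  proof -
    have [measurable]: "f \<in> borel_measurable M" "g \<in> borel_measurable M"
      using that by (auto simp: Lp_rel_def Lp_fun_def)
    have "AE x in M. f x = g x"
      using that by (auto simp: Lp_rel_def)
    then have "AE x in M. norm (g x) powr p = norm (f x) powr p"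
      by eventually_elim simp
    then have "(\<integral>x. norm (g x) powr p \<partial>M) = (\<integral>x. norm (f x) powr p \<partial>M)"
      by (intro integral_cong_AE) auto
    then show ?thesis by (simp add: Lp_fnorm_def)
  qed
  moreover have "f \<in> Lp_rel M p `` {f}"
    using assms by (auto simp: Lp_rel_def)
  ultimately have "Lp_fnorm M p ` (Lp_rel M p `` {f}) = {Lp_fnorm M p f}" by blast
  then show ?thesis by (simp add: Lp_def)
qed

lemma LWP_Lp_iff:
  assumes p: "0 < p"
  shows "LWP (Lp M p :: ('a \<Rightarrow> 'k::{real_normed_field, euclidean_space}) set normed_structure) r C
    \<longleftrightarrow> 1 < r \<and> 0 < C \<and>
     (\<forall>f\<in>Lp_fun M p. \<forall>g\<in>(Lp_fun M p :: ('a \<Rightarrow> 'k) set).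
        Lp_fnorm M p (\<lambda>x. f x + g x) powr r + C * Lp_fnorm M p (\<lambda>x. f x - g x) powr r
          \<le> 2 powr (r - 1) * (Lp_fnorm M p f powr r + Lp_fnorm M p g powr r))"
proof -
  have carrier: "vcarrier (Lp M p :: ('a \<Rightarrow> 'k) set normed_structure)
      = (\<lambda>f. Lp_rel M p `` {f}) ` Lp_fun M p"
    by (auto simp: Lp_def quotient_def)
  show ?thesis
    unfolding LWP_def carrier
    by (simp add: Lp_vadd Lp_vsub Lp_vnorm Lp_fun_add Lp_fun_diff p)
qed

lemma UWP_Lp_iff:
  assumes p: "0 < p"
  shows "UWP (Lp M p :: ('a \<Rightarrow> 'k::{real_normed_field, euclidean_space}) set normed_structure) r C
    \<longleftrightarrow> 1 < r \<and> 0 < C \<and>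
     (\<forall>f\<in>Lp_fun M p. \<forall>g\<in>(Lp_fun M p :: ('a \<Rightarrow> 'k) set).
        Lp_fnorm M p (\<lambda>x. f x + g x) powr r + C * Lp_fnorm M p (\<lambda>x. f x - g x) powr r
          \<ge> 2 powr (r - 1) * (Lp_fnorm M p f powr r + Lp_fnorm M p g powr r))"
proof -
  have carrier: "vcarrier (Lp M p :: ('a \<Rightarrow> 'k) set normed_structure)
      = (\<lambda>f. Lp_rel M p `` {f}) ` Lp_fun M p"
    by (auto simp: Lp_def quotient_def)
  show ?thesis
    unfolding UWP_def carrier
    by (simp add: Lp_vadd Lp_vsub Lp_vnorm Lp_fun_add Lp_fun_diff p)
qed


section \<open>Nondegeneracy of the measure\<close>

text \<open>Optimality fails for degenerate measures: every constant works on \<open>L\<^sup>p = {0}\<close>, and on a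
  one-dimensional \<open>L\<^sup>p\<close> the optimal constant is \<open>1\<close>, in the
  upper law for \<open>r \<le> 2\<close> and in the lower law for \<open>r \<ge> 2\<close>, whatever \<open>p\<close> is. The two conditions say exactly
  that \<open>L\<^sup>p \<noteq> {0}\<close> and that \<open>L\<^sup>p\<close> has dimension at least two.\<close>

definition Lp_nonzero :: "'a measure \<Rightarrow> bool" where
  "Lp_nonzero M \<longleftrightarrow> (\<exists>A\<in>sets M. 0 < emeasure M A \<and> emeasure M A < \<infinity>)"

definition Lp_dim_ge_2 :: "'a measure \<Rightarrow> bool" where
  "Lp_dim_ge_2 M \<longleftrightarrow> (\<exists>A\<in>sets M. \<exists>B\<in>sets M. A \<inter> B = {} \<and>
     0 < emeasure M A \<and> emeasure M A < \<infinity> \<and> 0 < emeasure M B \<and> emeasure M B < \<infinity>)"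

end

theory Submission
  imports Defs
begin

text \<open>Everything is reduced to two nonnegative numbers. Write \<open>m\<^sub>p(a,b)\<close> for the \<open>p\<close>-th power mean
  and consider, for \<open>0 \<le> b \<le> a\<close>, the inequality between
  \<open>(a + b)\<^sup>r + C (a - b)\<^sup>r\<close> and \<open>(2 m\<^sub>p(a,b))\<^sup>r\<close>: the two-point lower law if the former is at most the
  latter, the two-point upper law in the opposite case.

  A two-point law passes to \<open>L\<^sup>p\<close> in two steps. First, for scalars \<open>u\<close>, \<open>v\<close> of fixed norms the
  quantity \<open>|u + v|\<^sup>r + C |u - v|\<^sup>r\<close> is a convex (\<open>r \<ge> 2\<close>) or concave (\<open>r \<le> 2\<close>) function of the inner
  product \<open>u \<bullet> v\<close>, so its maximum, or minimum, is attained when \<open>u\<close> and \<open>v\<close> are parallel, and this is the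
  two-point case (\<open>two_point_lower_norm\<close>, \<open>two_point_upper_norm\<close>). Secondly, the scalar law is raised to the power
  \<open>p / r\<close> and integrated; the terms with \<open>u + v\<close> and \<open>u - v\<close> are separated by Minkowski's inequality with
  exponent \<open>p / r\<close>, in its reverse form if \<open>p \<le> r\<close>, and at the end \<open>m\<^sub>p\<close> is compared with \<open>m\<^sub>r\<close>
  (\<open>LWP_Lp_of_two_point_lower\<close>, \<open>UWP_Lp_of_two_point_upper\<close>).

  Conversely, if \<open>L\<^sup>p\<close> has dimension at least two it contains a copy of the two-dimensional
  \<open>\<ell>\<^sup>p\<close>, and the weak parallelogram law for \<open>(a,b)\<close> and \<open>(b,a)\<close> is precisely the two-point law with the
  same constant. So optimality becomes a question about two numbers, and by homogeneity the best
  constant in the two-point lower law is \<open>C\<^sub>p\<^sub>,\<^sub>r\<close> (\<open>two_point_lower_iff_le_wp_const\<close>). For the constant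
  \<open>1\<close> it suffices to test the law on \<open>f\<close> and \<open>- f\<close>.

  It remains to know enough two-point laws. Lower laws with constant \<open>1\<close> for \<open>r \<ge> max p q\<close> follow
  from Clarkson's inequality \<open>(1 + x)\<^sup>q + (1 - x)\<^sup>q \<le> 2 (1 + x\<^sup>p)\<^sup>q\<^sup>-\<^sup>1\<close>, proved by Friedrichs' device of
  a monotone function joining the two sides (\<open>Friedrichs_ineq\<close>). The upper laws are obtained by
  duality: by Hoelder's inequality, the lower law for the conjugate exponents with constant \<open>0 < C \<le> 1\<close> is
  equivalent to the upper law with constant \<open>C\<close> to the power \<open>- r / r'\<close>. In this way cases (a) and (f) are dual to
  (d) and (c), and (e) is dual to (b).\<close>


section \<open>Conjugate exponents and convexity of powers\<close>

lemma conjugate_exponents: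
  fixes p q :: real
  assumes "1 / p + 1 / q = 1" "1 < p"
  shows "1 < q" "p * (q - 1) = q" "q * (p - 1) = p" "(p - 1) * (q - 1) = 1" "q = p / (p - 1)"
    "p / q = p - 1" "q / p = q - 1" "q - q / p = 1"
proof -
  have q0: "q \<noteq> 0" using assms by auto
  have e: "p + q = p * q" using assms q0 by (simp add: field_simps)
  show q: "q = p / (p - 1)" using e assms by (simp add: field_simps)
  show "1 < q" using assms(2) by (simp add: q)
  show "p * (q - 1) = q" "q * (p - 1) = p" "(p - 1) * (q - 1) = 1"
    using e by (auto simp: algebra_simps)
  show "p / q = p - 1" "q / p = q - 1" "q - q / p = 1" using e assms q0 by (auto simp: field_simps)
qed

lemma conjugate_exponents_antimono:
  fixes p q r r' :: real
  assumes pq: "1 / p + 1 / q = 1" and rr': "1 / r + 1 / r' = 1" and p: "1 < p" "p \<le> r"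
  shows "r' \<le> q"
proof -
  have pos: "0 < q" "0 < r'"
    using conjugate_exponents(1)[OF pq] conjugate_exponents(1)[OF rr'] p by auto
  have "1 / r \<le> 1 / p" using p by (simp add: frac_le)
  then have "1 / q \<le> 1 / r'" using pq rr' by linarith
  then show ?thesis using pos by (simp add: field_simps)
qed

lemma powr_eq_sq_powr_half: "0 \<le> x \<Longrightarrow> x powr r = (x\<^sup>2) powr (r / 2)" for x r :: real
proof -
  assume "0 \<le> x"
  then have "x\<^sup>2 = x powr 2" by simp
  then show ?thesis by (simp only: powr_powr) simp
qed

lemma powr_convex_nonneg:
  fixes x y u v s :: real
  assumes "1 \<le> s" "0 \<le> x" "0 \<le> y" "0 \<le> u" "0 \<le> v" "u + v = 1"
  shows "(u * x + v * y) powr s \<le> u * x powr s + v * y powr s"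
proof (cases "x = 0 \<or> y = 0")
  case False
  then show ?thesis
    using convex_onD[OF powr_convex[OF assms(1)], of v x y] assms
    by (simp add: eq_diff_eq[of u 1 v, symmetric])
next
  case True
  have *: "w powr s \<le> w" if "0 \<le> w" "w \<le> 1" for w :: real
    using that assms(1) powr_le_one_le[of w s] by (cases "w = 0") auto
  show ?thesis
    using True *[of u] *[of v] assms by (auto simp: powr_mult intro!: mult_right_mono)
qed

lemma powr_concave_nonneg:
  fixes x y u v s :: real
  assumes "0 < s" "s \<le> 1" "0 \<le> x" "0 \<le> y" "0 \<le> u" "0 \<le> v" "u + v = 1"
  shows "u * x powr s + v * y powr s \<le> (u * x + v * y) powr s"
proof -
  have "(u * x powr s + v * y powr s) powr (1 / s) \<le> u * x + v * y"
    using powr_convex_nonneg[of "1 / s" "x powr s" "y powr s" u v] assms by (simp add: powr_powr)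
  from powr_mono2[OF _ _ this, of s] assms show ?thesis by (simp add: powr_powr)
qed

lemma powr_superadditive:
  fixes x y s :: real
  assumes "1 \<le> s" "0 \<le> x" "0 \<le> y"
  shows "x powr s + y powr s \<le> (x + y) powr s"
proof -
  have *: "z powr s = z * z powr (s - 1)" if "0 \<le> z" for z :: real
    using that by (simp add: powr_mult_base)
  have "x powr s + y powr s \<le> x * (x + y) powr (s - 1) + y * (x + y) powr (s - 1)"
    unfolding *[OF assms(2)] *[OF assms(3)] using assms
    by (intro add_mono mult_left_mono powr_mono2) auto
  also have "\<dots> = (x + y) powr s"
    using assms by (simp add: *[of "x + y"] distrib_right)
  finally show ?thesis .
qed

text \<open>Young's inequality for the vectors normalised to have norm \<open>1\<close>.\<close>

lemma Hoelder_two_terms: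
  fixes p q x1 x2 y1 y2 :: real
  assumes pq: "1 / p + 1 / q = 1" and p: "1 < p"
    and nn: "0 \<le> x1" "0 \<le> x2" "0 \<le> y1" "0 \<le> y2"
  shows "x1 * y1 + x2 * y2
    \<le> (x1 powr p + x2 powr p) powr (1 / p) * (y1 powr q + y2 powr q) powr (1 / q)"
proof -
  define X where "X = (x1 powr p + x2 powr p) powr (1 / p)"
  define Y where "Y = (y1 powr q + y2 powr q) powr (1 / q)"
  have q: "1 < q" using conjugate_exponents[OF pq p] by simp
  have Xp: "X powr p = x1 powr p + x2 powr p" and Yq: "Y powr q = y1 powr q + y2 powr q"
    using p q by (auto simp: X_def Y_def powr_powr)
  have nnXY: "0 \<le> X" "0 \<le> Y" by (auto simp: X_def Y_def)
  show ?thesis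
  proof (cases "X = 0 \<or> Y = 0")
    case True
    then have "(x1 = 0 \<and> x2 = 0) \<or> (y1 = 0 \<and> y2 = 0)"
      using Xp Yq p q nn by (auto simp: add_nonneg_eq_0_iff)
    then show ?thesis by auto
  next
    case False
    then have pos: "0 < X" "0 < Y" using nnXY by auto
    have "x1 / X * (y1 / Y) \<le> (x1 / X) powr p / p + (y1 / Y) powr q / q"
         "x2 / X * (y2 / Y) \<le> (x2 / X) powr p / p + (y2 / Y) powr q / q"
      using Youngs_inequality[of p q "x1 / X" "y1 / Y"] Youngs_inequality[of p q "x2 / X" "y2 / Y"]
        p q pq nn pos by auto
    then have "x1 / X * (y1 / Y) + x2 / X * (y2 / Y)
      \<le> ((x1 / X) powr p + (x2 / X) powr p) / p + ((y1 / Y) powr q + (y2 / Y) powr q) / q"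
      by (simp add: add_divide_distrib)
    also have "(x1 / X) powr p + (x2 / X) powr p = 1"
      using pos by (simp add: powr_divide Xp flip: add_divide_distrib) (metis Xp less_irrefl powr_gt_zero)
    also have "(y1 / Y) powr q + (y2 / Y) powr q = 1"
      using pos by (simp add: powr_divide Yq flip: add_divide_distrib) (metis Yq less_irrefl powr_gt_zero)
    finally have "(x1 * y1 + x2 * y2) / (X * Y) \<le> 1" using pq by (simp add: add_divide_distrib)
    then show ?thesis using pos by (simp add: X_def Y_def)
  qed
qed


section \<open>Power means and the two-point laws\<close>

definition pmean :: "real \<Rightarrow> real \<Rightarrow> real \<Rightarrow> real" where
  "pmean p a b = ((a powr p + b powr p) / 2) powr (1 / p)"

text \<open>This is the lower weak parallelogram law of the real two-dimensional \<open>\<ell>\<^sup>p\<close> for the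
  vectors \<open>(a,b)\<close> and \<open>(b,a)\<close>, divided by \<open>2\<close> to the power \<open>r / p\<close>.\<close>

definition two_point_lower :: "real \<Rightarrow> real \<Rightarrow> real \<Rightarrow> bool" where
  "two_point_lower p r C \<longleftrightarrow>
     (\<forall>a b. 0 \<le> b \<longrightarrow> b \<le> a \<longrightarrow> (a + b) powr r + C * (a - b) powr r \<le> (2 * pmean p a b) powr r)"

definition two_point_upper :: "real \<Rightarrow> real \<Rightarrow> real \<Rightarrow> bool" where
  "two_point_upper p r C \<longleftrightarrow>
     (\<forall>a b. 0 \<le> b \<longrightarrow> b \<le> a \<longrightarrow> (2 * pmean p a b) powr r \<le> (a + b) powr r + C * (a - b) powr r)"

lemma pmean_nonneg [simp]: "0 \<le> pmean p a b"
  by (simp add: pmean_def)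

lemma pmean_commute: "pmean p a b = pmean p b a"
  by (simp add: pmean_def add.commute)

lemma pmean_powr:
  assumes "p \<noteq> 0"
  shows "pmean p a b powr p = (a powr p + b powr p) / 2"
  using assms by (simp add: pmean_def powr_powr add_nonneg_nonneg)

lemma pmean_scale: "0 \<le> c \<Longrightarrow> p \<noteq> 0 \<Longrightarrow> pmean p (c * a) (c * b) = c * pmean p a b"
  by (simp add: pmean_def powr_mult powr_powr powr_divide flip: distrib_left)

text \<open>Jensen's inequality for the convex function \<open>x\<^sup>r\<^sup>/\<^sup>p\<close>.\<close>

lemma pmean_mono:
  assumes "0 < p" "p \<le> r" "0 \<le> a" "0 \<le> b"
  shows "pmean p a b \<le> pmean r a b"
proof -
  have "((a powr p + b powr p) / 2) powr (r / p) \<le> (a powr r + b powr r) / 2"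
    using powr_convex_nonneg[of "r / p" "a powr p" "b powr p" "1/2" "1/2"] assms
    by (simp add: powr_powr add_divide_distrib)
  from powr_mono2[OF _ _ this, of "1 / r"] assms show ?thesis
    by (simp add: pmean_def powr_powr)
qed

text \<open>The right-hand side is the first term in the numerator of \<open>C\<^sub>p\<^sub>,\<^sub>r\<close>.\<close>

lemma two_pmean_unit:
  assumes "0 < p" "0 \<le> t"
  shows "(2 * pmean p 1 t) powr r = 2 powr (r - r / p) * (1 + t powr p) powr (r / p)"
  by (simp add: pmean_def powr_mult powr_divide powr_powr powr_diff)

text \<open>Both sides of the law are homogeneous of degree \<open>r\<close>, so only the ratio \<open>t = b / a\<close> matters. At
  \<open>t = 1\<close> both sides agree, whatever \<open>C\<close> is, which is why the half-open interval suffices.\<close>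

lemma two_point_lower_iff_unit:
  assumes p: "0 < p"
  shows "two_point_lower p r C \<longleftrightarrow>
    (\<forall>t. 0 \<le> t \<and> t < 1 \<longrightarrow> (1 + t) powr r + C * (1 - t) powr r \<le> (2 * pmean p 1 t) powr r)"
    (is "_ \<longleftrightarrow> ?U")
proof
  assume "two_point_lower p r C"
  then show ?U unfolding two_point_lower_def by auto
next
  assume U: ?U
  show "two_point_lower p r C"
    unfolding two_point_lower_def
  proof (intro allI impI)
    fix a b :: real assume ab: "0 \<le> b" "b \<le> a"
    show "(a + b) powr r + C * (a - b) powr r \<le> (2 * pmean p a b) powr r"
    proof (cases "a = b")
      case True
      have "((a powr p + a powr p) / 2) powr (1 / p) = a"
        using p ab True by (simp add: powr_powr)
      then have "pmean p a a = a" by (simp only: pmean_def)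
      then show ?thesis using True by simp
    next
      case False
      define t where "t = b / a"
      have a: "0 < a" and t: "0 \<le> t" "t < 1" and b: "b = a * t"
        using False ab by (auto simp: t_def)
      have "(a + b) powr r + C * (a - b) powr r = a powr r * ((1 + t) powr r + C * (1 - t) powr r)"
        using a t by (simp add: b ring_distribs mult.left_commute flip: powr_mult)
      also have "\<dots> \<le> a powr r * (2 * pmean p 1 t) powr r"
        using U t by (intro mult_left_mono) auto
      also have "\<dots> = (2 * pmean p a b) powr r"
        using pmean_scale[of a p 1 t] a p by (simp add: b mult.left_commute flip: powr_mult)
      finally show ?thesis .
    qed
  qed
qed

lemma two_point_lower_abs:
  assumes "two_point_lower p r C" "0 \<le> a" "0 \<le> b"
  shows "(a + b) powr r + C * \<bar>a - b\<bar> powr r \<le> (2 * pmean p a b) powr r"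
  using assms(1)[unfolded two_point_lower_def, rule_format, of b a]
    assms(1)[unfolded two_point_lower_def, rule_format, of a b] assms(2,3)
  by (cases "b \<le> a") (simp_all add: abs_if add.commute pmean_commute)

lemma two_point_upper_abs:
  assumes "two_point_upper p r C" "0 \<le> a" "0 \<le> b"
  shows "(2 * pmean p a b) powr r \<le> (a + b) powr r + C * \<bar>a - b\<bar> powr r"
  using assms(1)[unfolded two_point_upper_def, rule_format, of b a]
    assms(1)[unfolded two_point_upper_def, rule_format, of a b] assms(2,3)
  by (cases "b \<le> a") (simp_all add: abs_if add.commute pmean_commute)


section \<open>The two-point lower law with constant 1\<close>

text \<open>Clarkson's inequality for two numbers. The function
  \<open>f c = (1 + c\<^sup>1\<^sup>-\<^sup>q x) (1 + c x)\<^sup>q\<^sup>-\<^sup>1 + (1 - c\<^sup>1\<^sup>-\<^sup>q x) (1 - c x)\<^sup>q\<^sup>-\<^sup>1\<close> takes the value of the left-hand side at \<open>c = 1\<close>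
  and that of the right-hand side at \<open>c = x\<^sup>p\<^sup>-\<^sup>1\<close>, where \<open>c\<^sup>1\<^sup>-\<^sup>q x = 1\<close> makes the second summand vanish. In
  the derivative almost everything cancels, and what is left is nonpositive for \<open>c \<le> 1\<close> because
  \<open>q \<ge> 2\<close>.\<close>

lemma Friedrichs_ineq:
  fixes p q x :: real
  assumes pq: "1 / p + 1 / q = 1" and p: "1 < p" "p \<le> 2" and x: "0 < x" "x < 1"
  shows "(1 + x) powr q + (1 - x) powr q \<le> 2 * (1 + x powr p) powr (q - 1)"
proof -
  note cj = conjugate_exponents[OF pq p(1)]
  have "2 \<le> p / (p - 1)" using p by (simp add: field_simps)
  then have q2: "2 \<le> q" using cj(5) by simp
  define f where "f c = (1 + c powr (1 - q) * x) * (1 + c * x) powr (q - 1)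
    + (1 - c powr (1 - q) * x) * (1 - c * x) powr (q - 1)" for c
  have x1: "x powr (p - 1) \<le> 1" using x p by (intro powr_le1) auto
  have "f 1 \<le> f (x powr (p - 1))"
  proof (rule DERIV_nonpos_imp_nonincreasing[OF x1])
    fix c assume c: "x powr (p - 1) \<le> c" "c \<le> 1"
    have c0: "0 < c" using c(1) x by (smt (verit) powr_gt_zero)
    have cx: "c * x < 1" using c(2) x by (smt (verit) mult_left_le_one_le c0)
    let ?D = "(q - 1) * x * (1 - c powr (- q)) * ((1 + c * x) powr (q - 2) - (1 - c * x) powr (q - 2))"
    have pos: "0 < 1 + c * x" "0 < 1 - c * x" using c0 x cx by (auto intro: add_pos_pos)
    \<comment> \<open>Common factors are split off so that the terms of the derivative can be collected.\<close>
    have split: "(1 + c * x) powr (q - 1) = (1 + c * x) * (1 + c * x) powr (q - 2)"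
        "(1 - c * x) powr (q - 1) = (1 - c * x) * (1 - c * x) powr (q - 2)"
        "c powr (1 - q) = c * c powr (- q)"
      using pos c0 by (simp_all add: powr_mult_base)
    have "(f has_real_derivative
        ((1 - q) * c powr (- q) * x * (1 + c * x) powr (q - 1)
          + (1 + c powr (1 - q) * x) * ((q - 1) * (1 + c * x) powr (q - 2) * x)
          - (1 - q) * c powr (- q) * x * (1 - c * x) powr (q - 1)
          - (1 - c powr (1 - q) * x) * ((q - 1) * (1 - c * x) powr (q - 2) * x))) (at c)"
      unfolding f_def using c0 pos
      by (auto intro!: derivative_eq_intros simp: algebra_simps)
    also have "(1 - q) * c powr (- q) * x * (1 + c * x) powr (q - 1)
          + (1 + c powr (1 - q) * x) * ((q - 1) * (1 + c * x) powr (q - 2) * x)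
          - (1 - q) * c powr (- q) * x * (1 - c * x) powr (q - 1)
          - (1 - c powr (1 - q) * x) * ((q - 1) * (1 - c * x) powr (q - 2) * x) = ?D"
      unfolding split by (simp add: algebra_simps)
    finally have "(f has_real_derivative ?D) (at c)" .
    moreover have "?D \<le> 0"
    proof (rule mult_nonpos_nonneg)
      have "c powr q \<le> 1" using c c0 q2 by (intro powr_le1) auto
      then have "1 \<le> c powr (- q)" using c0 by (simp add: powr_minus one_le_inverse)
      then show "(q - 1) * x * (1 - c powr (- q)) \<le> 0"
        using q2 x by (intro mult_nonneg_nonpos) auto
      have "(1 - c * x) powr (q - 2) \<le> (1 + c * x) powr (q - 2)"
        using pos c0 x q2 by (intro powr_mono2) auto
      then show "0 \<le> (1 + c * x) powr (q - 2) - (1 - c * x) powr (q - 2)" by simp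
    qed
    ultimately show "\<exists>y. DERIV f c :> y \<and> y \<le> 0" by blast
  qed
  moreover have "f 1 = (1 + x) powr q + (1 - x) powr q"
    using x by (simp add: f_def powr_mult_base)
  moreover have "f (x powr (p - 1)) = 2 * (1 + x powr p) powr (q - 1)"
  proof -
    have "(p - 1) * (1 - q) = - 1" using cj(4) by (simp add: algebra_simps)
    then have "(x powr (p - 1)) powr (1 - q) * x = 1"
      using x by (simp add: powr_powr powr_minus)
    moreover have "x powr (p - 1) * x = x powr p"
      using x by (simp add: powr_mult_base mult.commute)
    ultimately show ?thesis by (simp add: f_def)
  qed
  ultimately show ?thesis by simp
qed

text \<open>At \<open>r = q\<close> the homogeneous form of the law is exactly Clarkson's inequality, since \<open>q - q / p = 1\<close>
  and \<open>q / p = q - 1\<close>.\<close>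

lemma two_point_lower_conjugate:
  assumes pq: "1 / p + 1 / q = 1" and p: "1 < p" "p \<le> 2"
  shows "two_point_lower p q 1"
proof -
  note cj = conjugate_exponents[OF pq p(1)]
  have "(1 + t) powr q + (1 - t) powr q \<le> 2 * (1 + t powr p) powr (q - 1)"
    if t: "0 \<le> t" "t < 1" for t
    using Friedrichs_ineq[OF pq p, of t] t by (cases "t = 0") auto
  then show ?thesis
    using p by (simp add: two_point_lower_iff_unit two_pmean_unit cj(7,8))
qed

text \<open>Put \<open>m = min p q\<close>, so that \<open>m \<le> 2\<close> and the law holds for \<open>m\<close> and its conjugate exponent
  \<open>k = max p q\<close>. Raising \<open>r\<close> from \<open>k\<close> decreases the \<open>\<ell>\<^sup>r\<close>-norm of \<open>(a + b, a - b)\<close>, and replacing \<open>m\<close> by \<open>p\<close>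
  increases the power mean.\<close>

lemma two_point_lower_1:
  assumes pq: "1 / p + 1 / q = 1" and p: "1 < p" and r: "p \<le> r" "q \<le> r"
  shows "two_point_lower p r 1"
proof -
  have q: "1 < q" using conjugate_exponents[OF pq p] by simp
  obtain m k where mk: "1 / m + 1 / k = 1" "1 < m" "m \<le> 2" "m \<le> p" "k \<le> r"
  proof (cases "p \<le> 2")
    case False
    then have "p / (p - 1) \<le> 2" by (simp add: field_simps)
    then have "q \<le> 2" using conjugate_exponents(5)[OF pq p] by simp
    then show ?thesis
      using that[of q p] pq q r False by (simp add: add.commute)
  qed (use that[of p q] pq p r in auto)
  have k: "1 < k" using conjugate_exponents[OF mk(1,2)] by simp
  show ?thesis
    unfolding two_point_lower_def
  proof (intro allI impI)
    fix a b :: real assume ab: "0 \<le> b" "b \<le> a"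
    have "(a + b) powr r + 1 * (a - b) powr r
        = ((a + b) powr k) powr (r / k) + ((a - b) powr k) powr (r / k)"
      using k by (simp add: powr_powr)
    also have "\<dots> \<le> ((a + b) powr k + (a - b) powr k) powr (r / k)"
      using k mk by (intro powr_superadditive) auto
    also have "\<dots> \<le> ((2 * pmean m a b) powr k) powr (r / k)"
      using two_point_lower_conjugate[OF mk(1-3)] ab k mk by (intro powr_mono2) (auto simp: two_point_lower_def)
    also have "\<dots> = (2 * pmean m a b) powr r"
      using k by (simp add: powr_powr)
    also have "\<dots> \<le> (2 * pmean p a b) powr r"
      using pmean_mono[of m p a b] mk ab k by (intro powr_mono2) auto
    finally show "(a + b) powr r + 1 * (a - b) powr r \<le> (2 * pmean p a b) powr r" .
  qed
qed


section \<open>The best constant in the two-point lower law\<close>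

text \<open>The comparison of the arithmetic mean with the \<open>p\<close>-th power mean; it makes the infimum defining
  \<open>C\<^sub>p\<^sub>,\<^sub>r\<close> an infimum over a set bounded below.\<close>

lemma two_point_lower_0:
  assumes "1 \<le> p" "0 < r"
  shows "two_point_lower p r 0"
  unfolding two_point_lower_def
proof (intro allI impI)
  fix a b :: real assume ab: "0 \<le> b" "b \<le> a"
  have "a + b \<le> 2 * pmean p a b"
    using pmean_mono[of 1 p a b] assms ab by (simp add: pmean_def)
  then show "(a + b) powr r + 0 * (a - b) powr r \<le> (2 * pmean p a b) powr r"
    using assms ab by (auto intro: powr_mono2)
qed

lemma two_point_lower_iff_le_wp_const:
  assumes "1 \<le> p" "0 < r"
  shows "two_point_lower p r C \<longleftrightarrow> C \<le> wp_const p r"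
proof -
  define Q where "Q t = (2 powr (r - r / p) * (1 + t powr p) powr (r / p) - (1 + t) powr r)
                       / (1 - t) powr r" for t
  have law: "two_point_lower p r C \<longleftrightarrow> (\<forall>t\<in>{0..<1}. C \<le> Q t)" for C
    using assms by (auto simp: two_point_lower_iff_unit two_pmean_unit Q_def le_divide_eq algebra_simps)
  have "bdd_below (Q ` {0..<1})"
    using two_point_lower_0[OF assms] law by (auto intro!: bdd_belowI2[of _ 0])
  then show ?thesis
    unfolding law wp_const_def Q_def[symmetric] by (subst le_cINF_iff) auto
qed

text \<open>Both sides and their first derivatives in \<open>s\<close> agree at \<open>s = 0\<close>, and for the second derivatives the claim
  becomes \<open>2 \<le> (1 + s)\<^sup>p\<^sup>-\<^sup>2 + (1 - s)\<^sup>p\<^sup>-\<^sup>2\<close>. This is the inequality of the arithmetic and geometric means, because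
  the product of the two terms is \<open>(1 - s\<^sup>2)\<^sup>p\<^sup>-\<^sup>2 \<ge> 1\<close> for \<open>p \<le> 2\<close>.\<close>

lemma powr_sum_ge_quadratic:
  fixes p s :: real
  assumes p: "1 < p" "p \<le> 2" and s: "0 \<le> s" "s \<le> 1"
  shows "2 + p * (p - 1) * s\<^sup>2 \<le> (1 + s) powr p + (1 - s) powr p"
proof -
  define g where "g s = (1 + s) powr (p - 1) - (1 - s) powr (p - 1) - 2 * (p - 1) * s" for s
  define h where "h s = (1 + s) powr p + (1 - s) powr p - p * (p - 1) * s\<^sup>2" for s
  have g: "0 \<le> g s" if s: "0 \<le> s" "s < 1" for s
  proof -
    have "g 0 \<le> g s"
    proof (rule DERIV_nonneg_imp_nondecreasing[OF s(1)])
      fix x assume x: "0 \<le> x" "x \<le> s"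
      let ?a = "(1 + x) powr (p - 2)" and ?b = "(1 - x) powr (p - 2)"
      have "(g has_real_derivative (p - 1) * (?a + ?b - 2)) (at x)"
        unfolding g_def using x s by (auto intro!: derivative_eq_intros simp: algebra_simps)
      moreover have "2 \<le> ?a + ?b"
      proof -
        have "0 < 1 - x\<^sup>2" "1 - x\<^sup>2 \<le> 1" using x s by (auto simp: power_less_one_iff)
        then have "1 powr (p - 2) \<le> (1 - x\<^sup>2) powr (p - 2)"
          using p by (intro powr_mono2') auto
        also have "(1 - x\<^sup>2) powr (p - 2) = ?a * ?b"
          by (simp add: algebra_simps power2_eq_square flip: powr_mult)
        finally have ab: "1 \<le> ?a * ?b" by simp
        have "2\<^sup>2 \<le> (?a + ?b)\<^sup>2"
          using ab zero_le_power2[of "?a - ?b"] by (simp add: power2_eq_square algebra_simps)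
        then show ?thesis by (rule power2_le_imp_le) auto
      qed
      ultimately show "\<exists>y. DERIV g x :> y \<and> 0 \<le> y"
        using p by (intro exI[of _ "(p - 1) * (?a + ?b - 2)"]) auto
    qed
    then show ?thesis by (simp add: g_def)
  qed
  have "h 0 \<le> h s"
  proof (rule DERIV_nonneg_imp_increasing_open[OF s(1)])
    fix x assume x: "0 < x" "x < s"
    have "(h has_real_derivative p * g x) (at x)"
      unfolding h_def g_def using x s
      by (auto intro!: derivative_eq_intros simp: algebra_simps power2_eq_square)
    then show "\<exists>y. DERIV h x :> y \<and> 0 \<le> y"
      using g[of x] x s p by (intro exI[of _ "p * g x"]) auto
  next
    show "continuous_on {0..s} h"
      unfolding h_def using p s by (intro continuous_intros continuous_on_powr') auto
  qed
  then show ?thesis by (simp add: h_def)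
qed

text \<open>With \<open>a\<close> and \<open>b\<close> scaled to \<open>1 + s\<close> and \<open>1 - s\<close> the claim is \<open>1 + (p - 1) s\<^sup>2 \<le> m\<^sub>p(1 + s, 1 - s)\<^sup>2\<close>, which
  follows from the quadratic bound and Bernoulli's inequality for the exponent \<open>p / 2\<close>.\<close>

lemma two_point_lower_2:
  assumes p: "1 < p" "p \<le> 2"
  shows "two_point_lower p 2 (p - 1)"
  unfolding two_point_lower_def
proof (intro allI impI)
  fix a b :: real assume ab: "0 \<le> b" "b \<le> a"
  show "(a + b) powr 2 + (p - 1) * (a - b) powr 2 \<le> (2 * pmean p a b) powr 2"
  proof (cases "a = 0")
    case False
    define S where "S = a + b"
    define s where "s = (a - b) / S"
    have S: "0 < S" using False ab by (simp add: S_def)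
    have s: "0 \<le> s" "s \<le> 1" using S ab by (auto simp: s_def S_def)
    have Ss: "S * s = a - b" using S by (simp add: s_def)
    have "a = S / 2 * (1 + s)" "b = S / 2 * (1 - s)"
      using Ss by (simp_all add: S_def algebra_simps)
    then have 2: "2 * pmean p a b = S * pmean p (1 + s) (1 - s)"
      using pmean_scale[of "S / 2" p "1 + s" "1 - s"] S p by (simp del: times_divide_eq_left)
    define z where "z = (p - 1) * s\<^sup>2"
    have z: "0 \<le> z" using p by (simp add: z_def)
    \<comment> \<open>Bernoulli's inequality, as Young's inequality with second factor 1.\<close>
    have "(1 + z) powr (p / 2) \<le> 1 + p / 2 * z"
    proof (cases "p = 2")
      case False
      then show ?thesis
        using Youngs_inequality_0[of "p / 2" "1 - p / 2" "1 + z" 1] p z by (simp add: field_simps)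
    qed (use z in auto)
    also have "\<dots> \<le> pmean p (1 + s) (1 - s) powr p"
      using powr_sum_ge_quadratic[OF p s] p by (simp add: pmean_powr z_def)
    finally have "((1 + z) powr (p / 2)) powr (2 / p) \<le> (pmean p (1 + s) (1 - s) powr p) powr (2 / p)"
      using p by (intro powr_mono2) auto
    then have "1 + z \<le> (pmean p (1 + s) (1 - s))\<^sup>2"
      using p z by (simp add: powr_powr)
    then have "S\<^sup>2 * (1 + z) \<le> S\<^sup>2 * (pmean p (1 + s) (1 - s))\<^sup>2"
      by (intro mult_left_mono) auto
    also have "S\<^sup>2 * (1 + z) = (a + b)\<^sup>2 + (p - 1) * (a - b)\<^sup>2"
      by (simp add: z_def S_def[symmetric] Ss[symmetric] algebra_simps)
    finally show ?thesis using ab S by (simp add: 2 power_mult_distrib)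
  qed (use ab in auto)
qed

text \<open>The constant is not the best one; it serves to show that the best one is positive.\<close>

lemma two_point_lower_ge_2:
  assumes p: "1 < p" "p \<le> 2" and r: "2 \<le> r"
  shows "two_point_lower p r ((p - 1) powr (r / 2))"
  unfolding two_point_lower_def
proof (intro allI impI)
  fix a b :: real assume ab: "0 \<le> b" "b \<le> a"
  have sq: "(x\<^sup>2) powr (r / 2) = x powr r" if "0 \<le> x" for x :: real
  proof -
    have "x\<^sup>2 = x powr 2" using that by simp
    then show ?thesis by (simp only: powr_powr) simp
  qed
  have "(a + b) powr r + (p - 1) powr (r / 2) * (a - b) powr r
      = ((a + b)\<^sup>2) powr (r / 2) + ((p - 1) * (a - b)\<^sup>2) powr (r / 2)"
    using ab by (simp add: powr_mult sq)
  also have "\<dots> \<le> ((a + b)\<^sup>2 + (p - 1) * (a - b)\<^sup>2) powr (r / 2)"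
    using r p by (intro powr_superadditive) auto
  also have "\<dots> \<le> ((2 * pmean p a b)\<^sup>2) powr (r / 2)"
    using two_point_lower_2[OF p] ab r p by (intro powr_mono2) (auto simp: two_point_lower_def)
  also have "\<dots> = (2 * pmean p a b) powr r" by (rule sq) simp
  finally show "(a + b) powr r + (p - 1) powr (r / 2) * (a - b) powr r \<le> (2 * pmean p a b) powr r" .
qed

lemma wp_const_pos:
  assumes "1 < p" "p \<le> 2" "2 \<le> r"
  shows "0 < wp_const p r"
proof -
  have "(p - 1) powr (r / 2) \<le> wp_const p r"
    using two_point_lower_ge_2[OF assms] assms by (simp add: two_point_lower_iff_le_wp_const)
  then show ?thesis using assms by (smt (verit) powr_gt_zero)
qed

text \<open>The quotient defining \<open>C\<^sub>p\<^sub>,\<^sub>r\<close> takes at \<open>t = 0\<close> the value \<open>2\<^sup>r\<^sup>/\<^sup>q - 1\<close>, which is at most \<open>1\<close> when \<open>r \<le> q\<close>.\<close>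

lemma wp_const_le_1:
  assumes pq: "1 / p + 1 / q = 1" and p: "1 < p" and r: "0 < r" "r \<le> q"
  shows "wp_const p r \<le> 1"
proof -
  have law: "two_point_lower p r (wp_const p r)" using p r by (simp add: two_point_lower_iff_le_wp_const)
  have "1 + wp_const p r \<le> 2 powr (r - r / p)"
    using law[unfolded two_point_lower_def, rule_format, of 0 1] p two_pmean_unit[of p 0 r] by simp
  also have "r - r / p = r * (1 / q)"
  proof -
    have "1 / q = 1 - 1 / p" using pq by simp
    then show ?thesis by (simp only: right_diff_distrib) simp
  qed
  also have "2 powr (r * (1 / q)) \<le> (2 :: real) powr 1"
    using r by (intro powr_mono) auto
  finally show ?thesis by simp
qed


section \<open>Duality between the two-point laws\<close>

text \<open>The lower law is applied to \<open>\<alpha> = a\<^sup>p\<^sup>-\<^sup>1\<close> and \<open>\<beta> = b\<^sup>p\<^sup>-\<^sup>1\<close>, the functional that attains the norm of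
  \<open>(a,b)\<close>: then \<open>a \<alpha> + b \<beta> = 2 m\<^sup>p\<close> for \<open>m = m\<^sub>p(a,b)\<close>, while \<open>m\<^sub>q(\<alpha>,\<beta>) = m\<^sup>p\<^sup>-\<^sup>1\<close>. Writing
  \<open>2 (a \<alpha> + b \<beta>) = (a + b) (\<alpha> + \<beta>) + (a - b) (\<alpha> - \<beta>)\<close> and using Hoelder's inequality with exponents \<open>r\<close>, \<open>r'\<close>
  bounds \<open>4 m\<^sup>p\<close> by \<open>A\<^sup>1\<^sup>/\<^sup>r \<cdot> 2 m\<^sup>p\<^sup>-\<^sup>1\<close>, where \<open>A\<close> is the right-hand side of the upper law.\<close>

lemma two_point_upper_of_two_point_lower:
  assumes pq: "1 / p + 1 / q = 1" and p: "1 < p"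
    and rr': "1 / r + 1 / r' = 1" and r: "1 < r"
    and C: "0 < C" and law: "two_point_lower q r' C"
  shows "two_point_upper p r (C powr (- (r / r')))"
  unfolding two_point_upper_def
proof (intro allI impI)
  fix a b :: real assume ab: "0 \<le> b" "b \<le> a"
  note cp = conjugate_exponents[OF pq p] and cr = conjugate_exponents[OF rr' r]
  define m where "m = pmean p a b"
  define \<alpha> where "\<alpha> = a powr (p - 1)"
  define \<beta> where "\<beta> = b powr (p - 1)"
  define A where "A = (a + b) powr r + C powr (- (r / r')) * (a - b) powr r"
  have \<alpha>\<beta>: "0 \<le> \<beta>" "\<beta> \<le> \<alpha>"
    using ab p by (auto simp: \<alpha>_def \<beta>_def intro: powr_mono2)
  have m\<alpha>\<beta>: "pmean q \<alpha> \<beta> = m powr (p - 1)"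
  proof -
    have "(p - 1) * q = p" "1 / q = (p - 1) / p"
      using cp p by (auto simp: field_simps)
    then show ?thesis by (simp add: pmean_def \<alpha>_def \<beta>_def m_def powr_powr)
  qed
  have mp: "m powr p = m * m powr (p - 1)"
    by (simp add: powr_mult_base m_def)
  have "4 * m powr p = 2 * (a * \<alpha> + b * \<beta>)"
    using p ab by (simp add: m_def pmean_powr \<alpha>_def \<beta>_def powr_mult_base)
  \<comment> \<open>The factor \<open>C\<close> of the lower law is distributed over the two vectors of the pairing.\<close>
  also have "\<dots> = (a + b) * (\<alpha> + \<beta>)
      + (C powr (- (1 / r')) * (a - b)) * (C powr (1 / r') * (\<alpha> - \<beta>))"
  proof -
    have 1: "C powr (- (1 / r')) * C powr (1 / r') = 1" using C by (simp flip: powr_add)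
    have "(C powr (- (1 / r')) * (a - b)) * (C powr (1 / r') * (\<alpha> - \<beta>))
        = (C powr (- (1 / r')) * C powr (1 / r')) * ((a - b) * (\<alpha> - \<beta>))"
      by (simp only: ac_simps)
    also have "\<dots> = (a - b) * (\<alpha> - \<beta>)" unfolding 1 by simp
    finally have 2: "(C powr (- (1 / r')) * (a - b)) * (C powr (1 / r') * (\<alpha> - \<beta>))
      = (a - b) * (\<alpha> - \<beta>)" .
    show ?thesis unfolding 2 by (simp add: algebra_simps)
  qed
  also have "\<dots> \<le> ((a + b) powr r + (C powr (- (1 / r')) * (a - b)) powr r) powr (1 / r)
      * ((\<alpha> + \<beta>) powr r' + (C powr (1 / r') * (\<alpha> - \<beta>)) powr r') powr (1 / r')"
    using ab \<alpha>\<beta> by (intro Hoelder_two_terms[OF rr' r]) auto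
  also have "\<dots> = A powr (1 / r) * ((\<alpha> + \<beta>) powr r' + C * (\<alpha> - \<beta>) powr r') powr (1 / r')"
    using C cr(1) by (simp add: A_def powr_mult powr_powr)
  also have "\<dots> \<le> A powr (1 / r) * ((2 * pmean q \<alpha> \<beta>) powr r') powr (1 / r')"
    using law \<alpha>\<beta> C cr(1) unfolding two_point_lower_def by (intro mult_left_mono powr_mono2) auto
  also have "\<dots> = A powr (1 / r) * (2 * m powr (p - 1))"
    using cr(1) by (simp add: powr_powr m\<alpha>\<beta>)
  finally have *: "4 * m powr p \<le> A powr (1 / r) * (2 * m powr (p - 1))" .
  have "2 * m \<le> A powr (1 / r)"
  proof (cases "m = 0")
    case False
    then have "0 < m powr (p - 1)" by simp
    then show ?thesis using * unfolding mp by simp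
  qed auto
  then have "(2 * m) powr r \<le> (A powr (1 / r)) powr r"
    using r by (intro powr_mono2) (auto simp: m_def)
  also have "\<dots> = A" using r C ab by (simp add: A_def powr_powr)
  finally show "(2 * pmean p a b) powr r \<le> (a + b) powr r + C powr (- (r / r')) * (a - b) powr r"
    by (simp add: m_def A_def)
qed

text \<open>The converse duality. Here the vector \<open>(S,T)\<close> attains equality in Hoelder's inequality with
  exponents \<open>r\<close>, \<open>r'\<close> against \<open>(a + b, a - b)\<close> in the norm weighted by \<open>D\<close>, and the upper law is applied to
  \<open>S + T\<close> and \<open>S - T\<close>. The hypothesis \<open>1 \<le> C\<close> gives \<open>D \<le> 1\<close>, hence \<open>T \<le> S\<close>, so that these numbers are
  nonnegative.\<close>

lemma two_point_lower_of_two_point_upper: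
  assumes pq: "1 / p + 1 / q = 1" and p: "1 < p"
    and rr': "1 / r + 1 / r' = 1" and r: "1 < r"
    and C: "1 \<le> C" and law: "two_point_upper p r C"
  shows "two_point_lower q r' (C powr (- (r' / r)))"
  unfolding two_point_lower_def
proof (intro allI impI)
  fix a b :: real assume ab: "0 \<le> b" "b \<le> a"
  note cp = conjugate_exponents[OF pq p] and cr = conjugate_exponents[OF rr' r]
  define D where "D = C powr (- (r' / r))"
  define S where "S = (a + b) powr (r' - 1)"
  define T where "T = D * (a - b) powr (r' - 1)"
  define A where "A = (a + b) powr r' + D * (a - b) powr r'"
  have D: "0 < D" "D \<le> 1"
    using C cr(1) r unfolding D_def by (auto simp: powr_minus intro!: inverse_le_1_iff[THEN iffD2] ge_one_powr_ge_zero)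
  have T: "0 \<le> T" using D by (simp add: T_def)
  have TS: "T \<le> S"
  proof -
    have "T \<le> 1 * (a - b) powr (r' - 1)"
      unfolding T_def using D by (intro mult_right_mono) auto
    also have "\<dots> \<le> S" unfolding S_def using ab cr(1) by (simp add: powr_mono2)
    finally show ?thesis .
  qed
  have A0: "0 \<le> A" using D by (simp add: A_def)
  have Sr: "S powr r = (a + b) powr r'" and Tr: "C * T powr r = D * (a - b) powr r'"
  proof -
    have *: "(r' - 1) * r = r'" using cr(2) by (simp add: mult.commute)
    show "S powr r = (a + b) powr r'" by (simp add: S_def powr_powr *)
    have "C * D powr r = C powr (1 - r')"
      using C r by (simp add: D_def powr_powr powr_mult_base)
    also have "\<dots> = D" by (simp add: D_def cr(7))
    finally show "C * T powr r = D * (a - b) powr r'"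
      by (simp only: T_def powr_mult powr_powr * mult.assoc[symmetric])
  qed
  have "2 * A = 2 * ((a + b) * S + (a - b) * T)"
  proof -
    have "x powr r' = x * x powr (r' - 1)" if "0 \<le> x" for x :: real
      using that by (simp add: powr_mult_base)
    from this[of "a + b"] this[of "a - b"] show ?thesis
      using ab by (simp add: A_def S_def T_def)
  qed
  also have "\<dots> = 2 * ((S + T) * a + (S - T) * b)" by (simp add: algebra_simps)
  also have "\<dots> \<le> 2 * (((S + T) powr p + (S - T) powr p) powr (1 / p) * (a powr q + b powr q) powr (1 / q))"
    using Hoelder_two_terms[OF pq p, of "S + T" "S - T" a b] T TS ab by simp
  also have "\<dots> = 2 * (2 * pmean p (S + T) (S - T) * pmean q a b)"
  proof -
    have "2 powr (1 / p) * 2 powr (1 / q) = (2 :: real)"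
      using pq by (simp flip: powr_add)
    then show ?thesis
      by (simp add: pmean_def powr_divide mult.assoc)
  qed
  also have "\<dots> \<le> 2 * (2 * A powr (1 / r) * pmean q a b)"
  proof -
    have "(2 * pmean p (S + T) (S - T)) powr r \<le> (2 * S) powr r + C * (2 * T) powr r"
      using law[unfolded two_point_upper_def, rule_format, of "S - T" "S + T"] T TS by simp
    also have "\<dots> = 2 powr r * A"
    proof -
      have "C * (2 * T) powr r = 2 powr r * (C * T powr r)" by (simp add: powr_mult)
      then show ?thesis by (simp add: powr_mult Sr Tr A_def distrib_left)
    qed
    finally have "((2 * pmean p (S + T) (S - T)) powr r) powr (1 / r) \<le> (2 powr r * A) powr (1 / r)"
      using r by (intro powr_mono2) auto
    then have "2 * pmean p (S + T) (S - T) \<le> 2 * A powr (1 / r)"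
      using r by (simp add: powr_powr powr_mult)
    then show ?thesis by (intro mult_left_mono mult_right_mono) auto
  qed
  finally have *: "A \<le> A powr (1 / r) * (2 * pmean q a b)" by (simp add: mult_ac)
  have "A powr (1 / r') \<le> 2 * pmean q a b"
  proof (cases "A = 0")
    case False
    then have "0 < A powr (1 / r)" by simp
    moreover have "A powr (1 / r) * A powr (1 / r') = A"
      using A0 by (simp only: powr_add[symmetric] rr') simp
    then have "A powr (1 / r) * A powr (1 / r') \<le> A powr (1 / r) * (2 * pmean q a b)"
      using * by (simp only:)
    ultimately show ?thesis by (rule mult_left_le_imp_le[rotated])
  qed auto
  then have "(A powr (1 / r')) powr r' \<le> (2 * pmean q a b) powr r'"
    using cr(1) by (intro powr_mono2) auto
  then show "(a + b) powr r' + C powr (- (r' / r)) * (a - b) powr r' \<le> (2 * pmean q a b) powr r'"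
    using cr(1) A0 by (simp add: powr_powr A_def D_def)
qed

lemma two_point_upper_1:
  assumes pq: "1 / p + 1 / q = 1" and p: "1 < p" and r: "1 < r" "r \<le> p" "r \<le> q"
  shows "two_point_upper p r 1"
proof -
  define r' where "r' = r / (r - 1)"
  have rr': "1 / r + 1 / r' = 1" using r by (simp add: r'_def field_simps)
  have q: "1 < q" using conjugate_exponents(1)[OF pq p] .
  have qp: "1 / q + 1 / p = 1" using pq by simp
  have "two_point_lower q r' 1"
    using conjugate_exponents_antimono[OF rr' pq] conjugate_exponents_antimono[OF rr' qp] q r
    by (intro two_point_lower_1[OF qp]) auto
  from two_point_upper_of_two_point_lower[OF pq p rr' r(1) zero_less_one this] show ?thesis by simp
qed


section \<open>From numbers to scalars\<close>

text \<open>As the angle between \<open>u\<close> and \<open>v\<close> varies, the squared norms of \<open>u + v\<close> and \<open>u - v\<close> move in opposite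
  directions along the segment between their values for parallel vectors.\<close>

lemma norm_add_diff_interpolate:
  fixes u v :: "'b :: real_inner"
  obtains l where "0 \<le> l" "l \<le> 1"
    "(norm (u + v))\<^sup>2 = l * (norm u + norm v)\<^sup>2 + (1 - l) * (norm u - norm v)\<^sup>2"
    "(norm (u - v))\<^sup>2 = (1 - l) * (norm u + norm v)\<^sup>2 + l * (norm u - norm v)\<^sup>2"
proof -
  define m where "m = norm u * norm v"
  have c: "\<bar>inner u v\<bar> \<le> m" unfolding m_def by (rule Cauchy_Schwarz_ineq2)
  define l where "l = (if m = 0 then 1 else (m + inner u v) / (2 * m))"
  have l: "0 \<le> l" "l \<le> 1"
    using c by (auto simp: l_def field_simps abs_le_iff split: if_splits)
  have lm: "(2 * l - 1) * m = inner u v"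
    using c by (auto simp: l_def field_simps)
  have "(norm (u + v))\<^sup>2 = (norm u)\<^sup>2 + (norm v)\<^sup>2 + 2 * ((2 * l - 1) * m)"
       "(norm (u - v))\<^sup>2 = (norm u)\<^sup>2 + (norm v)\<^sup>2 - 2 * ((2 * l - 1) * m)"
    unfolding lm by (simp_all add: power2_norm_eq_inner algebra_simps inner_commute)
  then show ?thesis
    using l by (intro that[of l]) (auto simp: m_def power2_eq_square algebra_simps)
qed

text \<open>For \<open>r \<ge> 2\<close> the power \<open>r / 2\<close> of the squared norms is convex, so the left-hand side is largest for
  parallel vectors. Equal directions give the larger of the two values, as \<open>C \<le> 1\<close>.\<close>

lemma two_point_lower_norm:
  fixes u v :: "'b :: real_inner"
  assumes r: "2 \<le> r" and C: "0 \<le> C" "C \<le> 1" and law: "two_point_lower p r C"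
  shows "norm (u + v) powr r + C * norm (u - v) powr r \<le> (2 * pmean p (norm u) (norm v)) powr r"
proof -
  obtain l where l: "0 \<le> l" "l \<le> 1"
    and sq: "(norm (u + v))\<^sup>2 = l * (norm u + norm v)\<^sup>2 + (1 - l) * (norm u - norm v)\<^sup>2"
      "(norm (u - v))\<^sup>2 = (1 - l) * (norm u + norm v)\<^sup>2 + l * (norm u - norm v)\<^sup>2"
    by (rule norm_add_diff_interpolate)
  define P where "P = (norm u + norm v) powr r"
  define N where "N = \<bar>norm u - norm v\<bar> powr r"
  have PN: "P = ((norm u + norm v)\<^sup>2) powr (r / 2)" "N = ((norm u - norm v)\<^sup>2) powr (r / 2)"
    unfolding P_def N_def using powr_eq_sq_powr_half[of "\<bar>norm u - norm v\<bar>" r]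
    by (auto intro: powr_eq_sq_powr_half)
  have "\<bar>norm u - norm v\<bar> \<le> norm u + norm v"
    using norm_ge_zero[of u] norm_ge_zero[of v] by linarith
  then have NP: "N \<le> P" unfolding N_def P_def using r by (intro powr_mono2) auto
  have "norm (u + v) powr r \<le> l * P + (1 - l) * N"
    using r l by (simp add: powr_eq_sq_powr_half[of "norm (u + v)"] sq PN powr_convex_nonneg)
  moreover have "norm (u - v) powr r \<le> (1 - l) * P + l * N"
    using r l by (simp add: powr_eq_sq_powr_half[of "norm (u - v)"] sq PN powr_convex_nonneg)
  ultimately have "norm (u + v) powr r + C * norm (u - v) powr r
      \<le> (l * P + (1 - l) * N) + C * ((1 - l) * P + l * N)"
    using C by (intro add_mono mult_left_mono)
  also have "\<dots> = P + C * N - (1 - l) * (1 - C) * (P - N)" by (simp add: algebra_simps)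
  also have "\<dots> \<le> P + C * N" using l C NP by simp
  also have "\<dots> \<le> (2 * pmean p (norm u) (norm v)) powr r"
    unfolding P_def N_def by (rule two_point_lower_abs[OF law]) auto
  finally show ?thesis .
qed

text \<open>For \<open>r \<le> 2\<close> the power \<open>r / 2\<close> is concave, so the right-hand side is smallest for
  parallel vectors. Equal directions give the smaller of the two values, as \<open>C \<ge> 1\<close>.\<close>

lemma two_point_upper_norm:
  fixes u v :: "'b :: real_inner"
  assumes r: "0 < r" "r \<le> 2" and C: "1 \<le> C" and law: "two_point_upper p r C"
  shows "(2 * pmean p (norm u) (norm v)) powr r \<le> norm (u + v) powr r + C * norm (u - v) powr r"
proof -
  obtain l where l: "0 \<le> l" "l \<le> 1"
    and sq: "(norm (u + v))\<^sup>2 = l * (norm u + norm v)\<^sup>2 + (1 - l) * (norm u - norm v)\<^sup>2"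
      "(norm (u - v))\<^sup>2 = (1 - l) * (norm u + norm v)\<^sup>2 + l * (norm u - norm v)\<^sup>2"
    by (rule norm_add_diff_interpolate)
  define P where "P = (norm u + norm v) powr r"
  define N where "N = \<bar>norm u - norm v\<bar> powr r"
  have PN: "P = ((norm u + norm v)\<^sup>2) powr (r / 2)" "N = ((norm u - norm v)\<^sup>2) powr (r / 2)"
    unfolding P_def N_def using powr_eq_sq_powr_half[of "\<bar>norm u - norm v\<bar>" r]
    by (auto intro: powr_eq_sq_powr_half)
  have "\<bar>norm u - norm v\<bar> \<le> norm u + norm v"
    using norm_ge_zero[of u] norm_ge_zero[of v] by linarith
  then have NP: "N \<le> P" unfolding N_def P_def using r by (intro powr_mono2) auto
  have "(2 * pmean p (norm u) (norm v)) powr r \<le> P + C * N"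
    unfolding P_def N_def by (rule two_point_upper_abs[OF law]) auto
  also have "\<dots> \<le> P + C * N + (1 - l) * (C - 1) * (P - N)" using l C NP by simp
  also have "\<dots> = (l * P + (1 - l) * N) + C * ((1 - l) * P + l * N)" by (simp add: algebra_simps)
  also have "\<dots> \<le> norm (u + v) powr r + C * norm (u - v) powr r"
  proof (intro add_mono mult_left_mono)
    show "l * P + (1 - l) * N \<le> norm (u + v) powr r"
      using r l by (simp add: powr_eq_sq_powr_half[of "norm (u + v)"] sq PN powr_concave_nonneg)
    show "(1 - l) * P + l * N \<le> norm (u - v) powr r"
      using r l by (simp add: powr_eq_sq_powr_half[of "norm (u - v)"] sq PN powr_concave_nonneg)
  qed (use C in auto)
  finally show ?thesis .
qed


section \<open>From scalars to the Lebesgue space\<close>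

lemma weighted_powr:
  fixes A T x s :: real
  assumes "0 < A" "0 < T" "0 \<le> x"
  shows "A / T * (x / (A / T)) powr s = T powr (s - 1) * (A powr (1 - s) * x powr s)"
  using assms by (simp add: powr_divide powr_diff powr_mult)

text \<open>In the next two inequalities equality holds for \<open>x = A\<close> and \<open>y = B\<close>; this is what makes them lose
  nothing after integration.\<close>

lemma weighted_powr_self:
  fixes A B s :: real
  assumes "0 \<le> A" "0 \<le> B"
  shows "(A + B) powr (s - 1) * (A powr (1 - s) * A powr s + B powr (1 - s) * B powr s) = (A + B) powr s"
proof -
  have "(A + B) powr (s - 1) * (A powr (1 - s) * A powr s + B powr (1 - s) * B powr s)
      = (A + B) * (A + B) powr (s - 1)"
    using assms by (simp flip: powr_add)
  then show ?thesis using assms by (simp add: powr_mult_base)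
qed

text \<open>Minkowski's inequality before integration. Integrated with \<open>A\<close> and \<open>B\<close> the
  \<open>L\<^sup>s\<close>-quasinorms of \<open>x\<close> and \<open>y\<close>, the left-hand side becomes \<open>(A + B)\<^sup>s\<close>, so this yields the reverse
  triangle inequality. It is Jensen's inequality with weights \<open>A / (A + B)\<close> and \<open>B / (A + B)\<close>.\<close>

lemma powr_add_ge_weighted:
  fixes A B x y s :: real
  assumes s: "0 < s" "s \<le> 1" and nn: "0 \<le> A" "0 \<le> B" "0 \<le> x" "0 \<le> y"
  shows "(A + B) powr (s - 1) * (A powr (1 - s) * x powr s + B powr (1 - s) * y powr s) \<le> (x + y) powr s"
proof (cases "A = 0 \<or> B = 0")
  case False
  then have pos: "0 < A" "0 < B" using nn by auto
  have "A / (A + B) * (x / (A / (A + B))) powr s + B / (A + B) * (y / (B / (A + B))) powr s \<le> (x + y) powr s"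
    using powr_concave_nonneg[of s "x / (A / (A + B))" "y / (B / (A + B))" "A / (A + B)" "B / (A + B)"] pos s nn
    by (simp flip: add_divide_distrib)
  then show ?thesis
    using pos nn by (simp only: weighted_powr add_pos_pos distrib_left)
next
  case True
  have "z powr (s - 1) * (z powr (1 - s) * w) \<le> w" if "0 \<le> w" for z w :: real
    using that by (cases "z = 0") (auto simp flip: powr_add mult.assoc)
  from this[of "x powr s" A] this[of "y powr s" B] True show ?thesis
    using powr_mono2[of s x "x + y"] powr_mono2[of s y "x + y"] s nn by auto
qed

text \<open>The same for \<open>s \<ge> 1\<close>, giving the triangle inequality in \<open>L\<^sup>s\<close>. A weight that vanishes has to be
  excluded unless its function vanishes as well.\<close>

lemma powr_add_le_weighted:
  fixes A B x y s :: real
  assumes s: "1 \<le> s" and nn: "0 \<le> A" "0 \<le> B" "0 \<le> x" "0 \<le> y"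
    and zero: "A = 0 \<Longrightarrow> x = 0" "B = 0 \<Longrightarrow> y = 0"
  shows "(x + y) powr s \<le> (A + B) powr (s - 1) * (A powr (1 - s) * x powr s + B powr (1 - s) * y powr s)"
proof (cases "A = 0 \<or> B = 0")
  case False
  then have pos: "0 < A" "0 < B" using nn by auto
  have "(x + y) powr s \<le> A / (A + B) * (x / (A / (A + B))) powr s + B / (A + B) * (y / (B / (A + B))) powr s"
    using powr_convex_nonneg[of s "x / (A / (A + B))" "y / (B / (A + B))" "A / (A + B)" "B / (A + B)"] pos s nn
    by (simp flip: add_divide_distrib)
  then show ?thesis
    using pos nn by (simp only: weighted_powr add_pos_pos distrib_left)
next
  case True
  have "z powr (s - 1) * (z powr (1 - s) * w) = w" if "z = 0 \<Longrightarrow> w = 0" for z w :: real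
    using that by (cases "z = 0") (auto simp flip: powr_add mult.assoc)
  then have eq: "A powr (s - 1) * (A powr (1 - s) * x powr s) = x powr s"
    "B powr (s - 1) * (B powr (1 - s) * y powr s) = y powr s"
    using zero by auto
  show ?thesis
  proof (cases "A = 0")
    case A: True
    show ?thesis by (simp add: A zero(1)[OF A] eq(2))
  next
    case False
    with True have B: "B = 0" by simp
    show ?thesis by (simp add: B zero(2)[OF B] eq(1))
  qed
qed

lemma Lp_fnorm_nonneg [simp]: "0 \<le> Lp_fnorm M p f"
  by (simp add: Lp_fnorm_def)

lemma Lp_fnorm_powr:
  assumes "p \<noteq> 0"
  shows "Lp_fnorm M p f powr p = (\<integral>x. norm (f x) powr p \<partial>M)"
  using assms by (simp add: Lp_fnorm_def powr_powr integral_nonneg_AE)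

lemma Lp_fnorm_eq_0_AE:
  assumes "p \<noteq> 0" "f \<in> Lp_fun M p" "Lp_fnorm M p f = 0"
  shows "AE x in M. f x = 0"
proof -
  have "(\<integral>x. norm (f x) powr p \<partial>M) = 0"
    using Lp_fnorm_powr[OF assms(1), of M f] assms(3) by simp
  then show ?thesis
    using integral_nonneg_eq_0_iff_AE[of M "\<lambda>x. norm (f x) powr p"] assms(2) by (simp add: Lp_fun_def)
qed

lemma Lp_fnorm_scale:
  fixes f :: "'a \<Rightarrow> 'k::{real_normed_field, euclidean_space}"
  assumes "p \<noteq> 0"
  shows "Lp_fnorm M p (\<lambda>x. of_real c * f x) = \<bar>c\<bar> * Lp_fnorm M p f"
  using assms by (simp add: Lp_fnorm_def norm_mult powr_mult powr_powr)

text \<open>In the proof \<open>A\<close> and \<open>B\<close> are the two terms of the left-hand side of the law, and \<open>s = p / r\<close>. The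
  weighted inequality and the law for scalars are combined pointwise and integrated, giving
  \<open>(A + B)\<^sup>s \<le> (2 m\<^sub>p(\<parallel>f\<parallel>, \<parallel>g\<parallel>))\<^sup>p\<close>.\<close>

lemma LWP_Lp_of_two_point_lower:
  assumes p: "1 < p" and r: "2 \<le> r" "p \<le> r" and C: "0 < C" "C \<le> 1" and law: "two_point_lower p r C"
  shows "LWP (Lp M p :: ('a \<Rightarrow> 'k::{real_normed_field, euclidean_space}) set normed_structure) r C"
  unfolding LWP_Lp_iff[OF less_trans[OF zero_less_one p]]
proof (intro conjI ballI)
  fix f g :: "'a \<Rightarrow> 'k" assume f: "f \<in> Lp_fun M p" and g: "g \<in> Lp_fun M p"
  define A where "A = Lp_fnorm M p (\<lambda>x. f x + g x) powr r"
  define B where "B = C * Lp_fnorm M p (\<lambda>x. f x - g x) powr r"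
  define s where "s = p / r"
  define K where "K = (A + B) powr (s - 1)"
  have p0: "0 < p" and s: "0 < s" "s \<le> 1" and rs: "r * s = p" using p r by (auto simp: s_def)
  have AB: "0 \<le> A" "0 \<le> B" using C by (auto simp: A_def B_def)
  have [simp]: "integrable M (\<lambda>x. norm (f x) powr p)" "integrable M (\<lambda>x. norm (g x) powr p)"
    "integrable M (\<lambda>x. norm (f x + g x) powr p)" "integrable M (\<lambda>x. norm (f x - g x) powr p)"
    using f g Lp_fun_add[OF p0 f g] Lp_fun_diff[OF p0 f g] by (auto simp: Lp_fun_def)
  have As: "A powr s = (\<integral>x. norm (f x + g x) powr p \<partial>M)"
    and Bs: "B powr s = C powr s * (\<integral>x. norm (f x - g x) powr p \<partial>M)"
    using p0 by (simp_all add: A_def B_def powr_mult powr_powr rs Lp_fnorm_powr)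
  have "(A + B) powr s = K * (A powr (1 - s) * A powr s + B powr (1 - s) * B powr s)"
    unfolding K_def using AB by (rule weighted_powr_self[symmetric])
  also have "\<dots> = (\<integral>x. K * (A powr (1 - s) * norm (f x + g x) powr p
        + B powr (1 - s) * (C powr s * norm (f x - g x) powr p)) \<partial>M)"
    by (simp add: As Bs)
  also have "\<dots> \<le> (\<integral>x. 2 powr (p - 1) * (norm (f x) powr p + norm (g x) powr p) \<partial>M)"
  proof (rule integral_mono)
    fix x
    have "K * (A powr (1 - s) * norm (f x + g x) powr p + B powr (1 - s) * (C powr s * norm (f x - g x) powr p))
      \<le> (norm (f x + g x) powr r + C * norm (f x - g x) powr r) powr s"
      using powr_add_ge_weighted[OF s AB, of "norm (f x + g x) powr r" "C * norm (f x - g x) powr r"] C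
      by (simp add: K_def powr_mult powr_powr rs)
    also have "\<dots> \<le> ((2 * pmean p (norm (f x)) (norm (g x))) powr r) powr s"
      using two_point_lower_norm[OF r(1) _ C(2) law] C s by (intro powr_mono2) auto
    also have "\<dots> = 2 powr (p - 1) * (norm (f x) powr p + norm (g x) powr p)"
      using p0 by (simp add: powr_powr rs powr_mult pmean_powr powr_diff)
    finally show "K * (A powr (1 - s) * norm (f x + g x) powr p + B powr (1 - s) * (C powr s * norm (f x - g x) powr p))
      \<le> 2 powr (p - 1) * (norm (f x) powr p + norm (g x) powr p)" .
  qed auto
  also have "\<dots> = (2 * pmean p (Lp_fnorm M p f) (Lp_fnorm M p g)) powr p"
    using p0 by (simp add: powr_mult pmean_powr Lp_fnorm_powr powr_diff)
  finally have "((A + B) powr s) powr (1 / s) \<le> ((2 * pmean p (Lp_fnorm M p f) (Lp_fnorm M p g)) powr p) powr (1 / s)"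
    using s by (intro powr_mono2) auto
  then have "A + B \<le> (2 * pmean p (Lp_fnorm M p f) (Lp_fnorm M p g)) powr r"
    using s AB p0 by (simp add: powr_powr) (simp add: s_def)
  also have "\<dots> \<le> (2 * pmean r (Lp_fnorm M p f) (Lp_fnorm M p g)) powr r"
    using p0 r by (intro powr_mono2 mult_left_mono pmean_mono) auto
  also have "\<dots> = 2 powr (r - 1) * (Lp_fnorm M p f powr r + Lp_fnorm M p g powr r)"
    using r by (simp add: powr_mult pmean_powr powr_diff)
  finally show "Lp_fnorm M p (\<lambda>x. f x + g x) powr r + C * Lp_fnorm M p (\<lambda>x. f x - g x) powr r
    \<le> 2 powr (r - 1) * (Lp_fnorm M p f powr r + Lp_fnorm M p g powr r)"
    by (simp add: A_def B_def)
qed (use p r C in auto)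

text \<open>The mirror image of the preceding proof. The weighted inequality holds only almost everywhere now: if
  \<open>A = 0\<close>, then \<open>f + g\<close> vanishes outside a null set.\<close>

lemma UWP_Lp_of_two_point_upper:
  assumes p: "1 < p" and r: "1 < r" "r \<le> 2" "r \<le> p" and C: "1 \<le> C" and law: "two_point_upper p r C"
  shows "UWP (Lp M p :: ('a \<Rightarrow> 'k::{real_normed_field, euclidean_space}) set normed_structure) r C"
  unfolding UWP_Lp_iff[OF less_trans[OF zero_less_one p]]
proof (intro conjI ballI)
  fix f g :: "'a \<Rightarrow> 'k" assume f: "f \<in> Lp_fun M p" and g: "g \<in> Lp_fun M p"
  define A where "A = Lp_fnorm M p (\<lambda>x. f x + g x) powr r"
  define B where "B = C * Lp_fnorm M p (\<lambda>x. f x - g x) powr r"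
  define s where "s = p / r"
  define K where "K = (A + B) powr (s - 1)"
  have p0: "0 < p" and s: "1 \<le> s" and rs: "r * s = p" using p r by (auto simp: s_def)
  have AB: "0 \<le> A" "0 \<le> B" using C by (auto simp: A_def B_def)
  have [simp]: "integrable M (\<lambda>x. norm (f x) powr p)" "integrable M (\<lambda>x. norm (g x) powr p)"
    "integrable M (\<lambda>x. norm (f x + g x) powr p)" "integrable M (\<lambda>x. norm (f x - g x) powr p)"
    using f g Lp_fun_add[OF p0 f g] Lp_fun_diff[OF p0 f g] by (auto simp: Lp_fun_def)
  have As: "A powr s = (\<integral>x. norm (f x + g x) powr p \<partial>M)"
    and Bs: "B powr s = C powr s * (\<integral>x. norm (f x - g x) powr p \<partial>M)"
    using p0 by (simp_all add: A_def B_def powr_mult powr_powr rs Lp_fnorm_powr)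
  have A0: "AE x in M. A = 0 \<longrightarrow> f x + g x = 0"
    using Lp_fnorm_eq_0_AE[OF _ Lp_fun_add[OF p0 f g]] p0 by (cases "A = 0") (auto simp: A_def)
  have B0: "AE x in M. B = 0 \<longrightarrow> f x - g x = 0"
    using Lp_fnorm_eq_0_AE[OF _ Lp_fun_diff[OF p0 f g]] p0 C by (cases "B = 0") (auto simp: B_def)
  have "2 powr (r - 1) * (Lp_fnorm M p f powr r + Lp_fnorm M p g powr r)
      = (2 * pmean r (Lp_fnorm M p f) (Lp_fnorm M p g)) powr r"
    using r by (simp add: powr_mult pmean_powr powr_diff)
  also have "\<dots> \<le> (2 * pmean p (Lp_fnorm M p f) (Lp_fnorm M p g)) powr r"
    using p0 r by (intro powr_mono2 mult_left_mono pmean_mono) auto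
  also have "\<dots> = ((2 * pmean p (Lp_fnorm M p f) (Lp_fnorm M p g)) powr p) powr (1 / s)"
    using p0 by (simp add: powr_powr s_def)
  also have "\<dots> \<le> ((A + B) powr s) powr (1 / s)"
  proof (rule powr_mono2)
    have "(2 * pmean p (Lp_fnorm M p f) (Lp_fnorm M p g)) powr p
        = (\<integral>x. 2 powr (p - 1) * (norm (f x) powr p + norm (g x) powr p) \<partial>M)"
      using p0 by (simp add: powr_mult pmean_powr Lp_fnorm_powr powr_diff)
    also have "\<dots> \<le> (\<integral>x. K * (A powr (1 - s) * norm (f x + g x) powr p
          + B powr (1 - s) * (C powr s * norm (f x - g x) powr p)) \<partial>M)"
    proof (rule integral_mono_AE)
      show "AE x in M. 2 powr (p - 1) * (norm (f x) powr p + norm (g x) powr p)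
        \<le> K * (A powr (1 - s) * norm (f x + g x) powr p
            + B powr (1 - s) * (C powr s * norm (f x - g x) powr p))"
        using A0 B0
      proof eventually_elim
        fix x assume zero: "A = 0 \<longrightarrow> f x + g x = 0" "B = 0 \<longrightarrow> f x - g x = 0"
        have "2 powr (p - 1) * (norm (f x) powr p + norm (g x) powr p)
            = ((2 * pmean p (norm (f x)) (norm (g x))) powr r) powr s"
          using p0 by (simp add: powr_powr rs powr_mult pmean_powr powr_diff)
        also have "\<dots> \<le> (norm (f x + g x) powr r + C * norm (f x - g x) powr r) powr s"
          using two_point_upper_norm[OF _ r(2) C law] r s by (intro powr_mono2) auto
        also have "\<dots> \<le> K * (A powr (1 - s) * norm (f x + g x) powr p
            + B powr (1 - s) * (C powr s * norm (f x - g x) powr p))"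
          using powr_add_le_weighted[OF s AB, of "norm (f x + g x) powr r" "C * norm (f x - g x) powr r"] C zero
          by (simp add: K_def powr_mult powr_powr rs)
        finally show "2 powr (p - 1) * (norm (f x) powr p + norm (g x) powr p)
          \<le> K * (A powr (1 - s) * norm (f x + g x) powr p
            + B powr (1 - s) * (C powr s * norm (f x - g x) powr p))" .
      qed
    qed auto
    also have "\<dots> = K * (A powr (1 - s) * A powr s + B powr (1 - s) * B powr s)"
      by (simp add: As Bs)
    also have "\<dots> = (A + B) powr s"
      unfolding K_def using AB by (rule weighted_powr_self)
    finally show "(2 * pmean p (Lp_fnorm M p f) (Lp_fnorm M p g)) powr p \<le> (A + B) powr s" .
  qed (use s in auto)
  also have "\<dots> = A + B" using s AB by (simp add: powr_powr)
  finally show "2 powr (r - 1) * (Lp_fnorm M p f powr r + Lp_fnorm M p g powr r)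
    \<le> Lp_fnorm M p (\<lambda>x. f x + g x) powr r + C * Lp_fnorm M p (\<lambda>x. f x - g x) powr r"
    by (simp add: A_def B_def)
qed (use p r C in auto)


section \<open>Necessary conditions on the constants\<close>

lemma Lp_nonzero_obtains:
  assumes M: "Lp_nonzero M" and p: "0 < p"
  obtains f :: "'a \<Rightarrow> 'k::{real_normed_field, euclidean_space}"
  where "f \<in> Lp_fun M p" "0 < Lp_fnorm M p f"
proof -
  obtain A where [measurable]: "A \<in> sets M" and A: "0 < emeasure M A" "emeasure M A < \<infinity>"
    using M by (auto simp: Lp_nonzero_def)
  define f :: "'a \<Rightarrow> 'k" where "f x = of_real (indicator A x)" for x
  have nf: "norm (f x) powr p = indicator A x" for x
    using p by (simp add: f_def indicator_def)
  have "f \<in> Lp_fun M p"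
  proof -
    have "integrable M (\<lambda>x. norm (f x) powr p)" unfolding nf using A by simp
    then show ?thesis by (simp add: Lp_fun_def f_def[abs_def])
  qed
  moreover have "0 < Lp_fnorm M p f"
    unfolding Lp_fnorm_def nf using A by (simp add: emeasure_eq_ennreal_measure top.not_eq_extremum)
  ultimately show ?thesis by (rule that)
qed

lemma Lp_opposite_obtains:
  fixes f :: "'a \<Rightarrow> 'k::{real_normed_field, euclidean_space}"
  assumes p: "0 < p" and f: "f \<in> Lp_fun M p"
  obtains g where "g \<in> Lp_fun M p" "Lp_fnorm M p g = Lp_fnorm M p f"
    "Lp_fnorm M p (\<lambda>x. f x + g x) = 0" "Lp_fnorm M p (\<lambda>x. f x - g x) = 2 * Lp_fnorm M p f"
proof
  show "(\<lambda>x. - f x) \<in> Lp_fun M p" using f by (auto simp: Lp_fun_def)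
  show "Lp_fnorm M p (\<lambda>x. - f x) = Lp_fnorm M p f" by (simp add: Lp_fnorm_def)
  show "Lp_fnorm M p (\<lambda>x. f x + - f x) = 0" by (simp add: Lp_fnorm_def)
  show "Lp_fnorm M p (\<lambda>x. f x - - f x) = 2 * Lp_fnorm M p f"
    using Lp_fnorm_scale[of p M 2 f] p by simp
qed

lemma LWP_Lp_le_1:
  assumes M: "Lp_nonzero M" and p: "0 < p"
    and law: "LWP (Lp M p :: ('a \<Rightarrow> 'k::{real_normed_field, euclidean_space}) set normed_structure) r C"
  shows "C \<le> 1"
proof -
  obtain f :: "'a \<Rightarrow> 'k" where f: "f \<in> Lp_fun M p" "0 < Lp_fnorm M p f"
    using Lp_nonzero_obtains[OF M p] .
  obtain g where g: "g \<in> Lp_fun M p" "Lp_fnorm M p g = Lp_fnorm M p f"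
    "Lp_fnorm M p (\<lambda>x. f x + g x) = 0" "Lp_fnorm M p (\<lambda>x. f x - g x) = 2 * Lp_fnorm M p f"
    using Lp_opposite_obtains[OF p f(1)] .
  have "Lp_fnorm M p (\<lambda>x. f x + g x) powr r + C * Lp_fnorm M p (\<lambda>x. f x - g x) powr r
      \<le> 2 powr (r - 1) * (Lp_fnorm M p f powr r + Lp_fnorm M p g powr r)"
    using law[unfolded LWP_Lp_iff[OF p]] f(1) g(1) by blast
  then have "0 powr r + C * (2 * Lp_fnorm M p f) powr r
      \<le> 2 powr (r - 1) * (Lp_fnorm M p f powr r + Lp_fnorm M p f powr r)"
    by (simp only: g(2-4))
  then have "C * (2 * Lp_fnorm M p f) powr r \<le> 1 * (2 * Lp_fnorm M p f) powr r"
    by (simp add: powr_diff powr_mult)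
  then show ?thesis using f(2) by (simp only: mult_le_cancel_right_pos powr_gt_zero)
qed

lemma UWP_Lp_ge_1:
  assumes M: "Lp_nonzero M" and p: "0 < p"
    and law: "UWP (Lp M p :: ('a \<Rightarrow> 'k::{real_normed_field, euclidean_space}) set normed_structure) r C"
  shows "1 \<le> C"
proof -
  obtain f :: "'a \<Rightarrow> 'k" where f: "f \<in> Lp_fun M p" "0 < Lp_fnorm M p f"
    using Lp_nonzero_obtains[OF M p] .
  obtain g where g: "g \<in> Lp_fun M p" "Lp_fnorm M p g = Lp_fnorm M p f"
    "Lp_fnorm M p (\<lambda>x. f x + g x) = 0" "Lp_fnorm M p (\<lambda>x. f x - g x) = 2 * Lp_fnorm M p f"
    using Lp_opposite_obtains[OF p f(1)] .
  have "2 powr (r - 1) * (Lp_fnorm M p f powr r + Lp_fnorm M p g powr r)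
      \<le> Lp_fnorm M p (\<lambda>x. f x + g x) powr r + C * Lp_fnorm M p (\<lambda>x. f x - g x) powr r"
    using law[unfolded UWP_Lp_iff[OF p]] f(1) g(1) by blast
  then have "2 powr (r - 1) * (Lp_fnorm M p f powr r + Lp_fnorm M p f powr r)
      \<le> 0 powr r + C * (2 * Lp_fnorm M p f) powr r"
    by (simp only: g(2-4))
  then have "1 * (2 * Lp_fnorm M p f) powr r \<le> C * (2 * Lp_fnorm M p f) powr r"
    by (simp add: powr_diff powr_mult)
  then show ?thesis using f(2) by (simp only: mult_le_cancel_right_pos powr_gt_zero)
qed

text \<open>The indicators of two disjoint sets, normalised in \<open>L\<^sup>p\<close>, span an isometric copy of the
  two-dimensional \<open>\<ell>\<^sup>p\<close>.\<close>

lemma Lp_dim_ge_2_obtains: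
  assumes M: "Lp_dim_ge_2 M" and p: "0 < p"
  obtains T :: "real \<Rightarrow> real \<Rightarrow> 'a \<Rightarrow> 'k::{real_normed_field, euclidean_space}"
  where "\<And>a b. T a b \<in> Lp_fun M p"
    "\<And>a b. Lp_fnorm M p (T a b) = 2 powr (1 / p) * pmean p \<bar>a\<bar> \<bar>b\<bar>"
    "\<And>a b c d. (\<lambda>x. T a b x + T c d x) = T (a + c) (b + d)"
    "\<And>a b c d. (\<lambda>x. T a b x - T c d x) = T (a - c) (b - d)"
proof -
  obtain A B where [measurable]: "A \<in> sets M" "B \<in> sets M" and disj: "A \<inter> B = {}"
    and A: "0 < emeasure M A" "emeasure M A < \<infinity>" and B: "0 < emeasure M B" "emeasure M B < \<infinity>"
    using M by (auto simp: Lp_dim_ge_2_def)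
  have mA: "0 < measure M A" and mB: "0 < measure M B"
    using A B by (auto simp: emeasure_eq_ennreal_measure top.not_eq_extremum)
  define w where "w x = measure M A powr (- (1 / p)) * indicator A x" for x
  define z where "z x = measure M B powr (- (1 / p)) * indicator B x" for x
  define T :: "real \<Rightarrow> real \<Rightarrow> 'a \<Rightarrow> 'k" where "T a b x = of_real (a * w x + b * z x)" for a b x
  have nT: "norm (T a b x) powr p
      = \<bar>a\<bar> powr p * (indicator A x / measure M A) + \<bar>b\<bar> powr p * (indicator B x / measure M B)" for a b x
  proof -
    have "norm (T a b x) = \<bar>a * w x + b * z x\<bar>" unfolding T_def by (rule norm_of_real)
    then show ?thesis
      using disj p mA mB
      by (cases "x \<in> A"; cases "x \<in> B")
        (auto simp: w_def z_def abs_mult powr_mult powr_powr powr_minus_divide powr_divide)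
  qed
  have int: "integrable M (\<lambda>x. norm (T a b x) powr p)" for a b
    unfolding nT using A B by (intro Bochner_Integration.integrable_add integrable_mult_right integrable_divide) auto
  show ?thesis
  proof (rule that)
    show "T a b \<in> Lp_fun M p" for a b
    proof -
      have "T a b \<in> borel_measurable M"
        unfolding T_def[abs_def] w_def[abs_def] z_def[abs_def] by measurable
      then show ?thesis using int by (simp add: Lp_fun_def)
    qed
    show "Lp_fnorm M p (T a b) = 2 powr (1 / p) * pmean p \<bar>a\<bar> \<bar>b\<bar>" for a b
    proof -
      have "(\<integral>x. norm (T a b x) powr p \<partial>M) = \<bar>a\<bar> powr p + \<bar>b\<bar> powr p"
        unfolding nT using A B mA mB by (subst Bochner_Integration.integral_add) auto
      then show ?thesis by (simp add: Lp_fnorm_def pmean_def powr_divide)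
    qed
    show "(\<lambda>x. T a b x + T c d x) = T (a + c) (b + d)" for a b c d
      by (rule ext) (simp add: T_def algebra_simps)
    show "(\<lambda>x. T a b x - T c d x) = T (a - c) (b - d)" for a b c d
      by (rule ext) (simp add: T_def algebra_simps)
  qed
qed

text \<open>The functions are the copies of \<open>(a,b)\<close> and \<open>(b,a)\<close>; their sum and difference are multiples of
  \<open>(1,1)\<close> and \<open>(1,-1)\<close>. So each term of a weak parallelogram law is \<open>2\<close> to the power \<open>r / p\<close> times the
  corresponding term of the two-point law.\<close>

lemma Lp_swapped_pair_obtains:
  fixes a b :: real
  assumes M: "Lp_dim_ge_2 M" and p: "0 < p" and ab: "0 \<le> b" "b \<le> a"
  obtains f g :: "'a \<Rightarrow> 'k::{real_normed_field, euclidean_space}"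
  where "f \<in> Lp_fun M p" "g \<in> Lp_fun M p"
    "Lp_fnorm M p (\<lambda>x. f x + g x) powr r = 2 powr (r / p) * (a + b) powr r"
    "Lp_fnorm M p (\<lambda>x. f x - g x) powr r = 2 powr (r / p) * (a - b) powr r"
    "2 powr (r - 1) * (Lp_fnorm M p f powr r + Lp_fnorm M p g powr r)
      = 2 powr (r / p) * (2 * pmean p a b) powr r"
proof -
  have diag: "pmean p c c = c" if "0 \<le> c" for c
  proof -
    have "pmean p c c = (c powr p) powr (1 / p)" by (simp add: pmean_def)
    then show ?thesis using p that by (simp add: powr_powr)
  qed
  show ?thesis
  proof (rule Lp_dim_ge_2_obtains[OF M p])
    fix T :: "real \<Rightarrow> real \<Rightarrow> 'a \<Rightarrow> 'k"
    assume T: "\<And>a b. T a b \<in> Lp_fun M p"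
      "\<And>a b. Lp_fnorm M p (T a b) = 2 powr (1 / p) * pmean p \<bar>a\<bar> \<bar>b\<bar>"
      "\<And>a b c d. (\<lambda>x. T a b x + T c d x) = T (a + c) (b + d)"
      "\<And>a b c d. (\<lambda>x. T a b x - T c d x) = T (a - c) (b - d)"
    show thesis
    proof (rule that[of "T a b" "T b a"])
      show "Lp_fnorm M p (\<lambda>x. T a b x + T b a x) powr r = 2 powr (r / p) * (a + b) powr r"
        using ab by (simp add: T diag powr_mult powr_powr add.commute[of b a])
      show "Lp_fnorm M p (\<lambda>x. T a b x - T b a x) powr r = 2 powr (r / p) * (a - b) powr r"
        using ab by (simp add: T diag powr_mult powr_powr abs_minus_commute[of b a])
      show "2 powr (r - 1) * (Lp_fnorm M p (T a b) powr r + Lp_fnorm M p (T b a) powr r)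
        = 2 powr (r / p) * (2 * pmean p a b) powr r"
        using ab by (simp add: T pmean_commute[of p b a] powr_mult powr_powr powr_diff)
    qed (rule T)+
  qed
qed

lemma two_point_lower_of_LWP_Lp:
  assumes M: "Lp_dim_ge_2 M" and p: "0 < p"
    and law: "LWP (Lp M p :: ('a \<Rightarrow> 'k::{real_normed_field, euclidean_space}) set normed_structure) r C"
  shows "two_point_lower p r C"
  unfolding two_point_lower_def
proof (intro allI impI)
  fix a b :: real assume ab: "0 \<le> b" "b \<le> a"
  obtain f g :: "'a \<Rightarrow> 'k" where fg: "f \<in> Lp_fun M p" "g \<in> Lp_fun M p"
    and n: "Lp_fnorm M p (\<lambda>x. f x + g x) powr r = 2 powr (r / p) * (a + b) powr r"
    "Lp_fnorm M p (\<lambda>x. f x - g x) powr r = 2 powr (r / p) * (a - b) powr r"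
    "2 powr (r - 1) * (Lp_fnorm M p f powr r + Lp_fnorm M p g powr r)
      = 2 powr (r / p) * (2 * pmean p a b) powr r"
    using Lp_swapped_pair_obtains[OF M p ab] .
  have "Lp_fnorm M p (\<lambda>x. f x + g x) powr r + C * Lp_fnorm M p (\<lambda>x. f x - g x) powr r
      \<le> 2 powr (r - 1) * (Lp_fnorm M p f powr r + Lp_fnorm M p g powr r)"
    using law[unfolded LWP_Lp_iff[OF p]] fg by blast
  then have "2 powr (r / p) * (a + b) powr r + C * (2 powr (r / p) * (a - b) powr r)
      \<le> 2 powr (r / p) * (2 * pmean p a b) powr r"
    by (simp only: n)
  then have "2 powr (r / p) * ((a + b) powr r + C * (a - b) powr r)
      \<le> 2 powr (r / p) * (2 * pmean p a b) powr r"
    by (simp only: distrib_left mult.left_commute)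
  then show "(a + b) powr r + C * (a - b) powr r \<le> (2 * pmean p a b) powr r"
    by (rule mult_left_le_imp_le) simp
qed

lemma two_point_upper_of_UWP_Lp:
  assumes M: "Lp_dim_ge_2 M" and p: "0 < p"
    and law: "UWP (Lp M p :: ('a \<Rightarrow> 'k::{real_normed_field, euclidean_space}) set normed_structure) r C"
  shows "two_point_upper p r C"
  unfolding two_point_upper_def
proof (intro allI impI)
  fix a b :: real assume ab: "0 \<le> b" "b \<le> a"
  obtain f g :: "'a \<Rightarrow> 'k" where fg: "f \<in> Lp_fun M p" "g \<in> Lp_fun M p"
    and n: "Lp_fnorm M p (\<lambda>x. f x + g x) powr r = 2 powr (r / p) * (a + b) powr r"
    "Lp_fnorm M p (\<lambda>x. f x - g x) powr r = 2 powr (r / p) * (a - b) powr r"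
    "2 powr (r - 1) * (Lp_fnorm M p f powr r + Lp_fnorm M p g powr r)
      = 2 powr (r / p) * (2 * pmean p a b) powr r"
    using Lp_swapped_pair_obtains[OF M p ab] .
  have "2 powr (r - 1) * (Lp_fnorm M p f powr r + Lp_fnorm M p g powr r)
      \<le> Lp_fnorm M p (\<lambda>x. f x + g x) powr r + C * Lp_fnorm M p (\<lambda>x. f x - g x) powr r"
    using law[unfolded UWP_Lp_iff[OF p]] fg by blast
  then have "2 powr (r / p) * (2 * pmean p a b) powr r
      \<le> 2 powr (r / p) * (a + b) powr r + C * (2 powr (r / p) * (a - b) powr r)"
    by (simp only: n)
  then have "2 powr (r / p) * (2 * pmean p a b) powr r
      \<le> 2 powr (r / p) * ((a + b) powr r + C * (a - b) powr r)"
    by (simp only: distrib_left mult.left_commute)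
  then show "(2 * pmean p a b) powr r \<le> (a + b) powr r + C * (a - b) powr r"
    by (rule mult_left_le_imp_le) simp
qed


section \<open>The weak parallelogram laws\<close>

lemma UWP_mono:
  assumes U: "UWP X r C" and C: "C \<le> C'"
  shows "UWP X r C'"
  unfolding UWP_def
proof (intro conjI ballI)
  fix x y assume xy: "x \<in> vcarrier X" "y \<in> vcarrier X"
  have "2 powr (r - 1) * (vnorm X x powr r + vnorm X y powr r)
      \<le> vnorm X (vadd X x y) powr r + C * vnorm X (vsub X x y) powr r"
    using U xy by (simp add: UWP_def)
  also have "\<dots> \<le> vnorm X (vadd X x y) powr r + C' * vnorm X (vsub X x y) powr r"
    using C by (intro add_left_mono mult_right_mono) auto
  finally show "2 powr (r - 1) * (vnorm X x powr r + vnorm X y powr r)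
      \<le> vnorm X (vadd X x y) powr r + C' * vnorm X (vsub X x y) powr r" .
qed (use U C in \<open>auto simp: UWP_def\<close>)

lemma LWP_Lp_1:
  assumes pq: "1 / p + 1 / q = 1" and p: "1 < p" and r: "p \<le> r" "q \<le> r"
  shows "LWP (Lp M p :: ('a \<Rightarrow> 'k::{real_normed_field, euclidean_space}) set normed_structure) r 1"
    "Lp_nonzero M \<Longrightarrow>
      optimal_LWP (Lp M p :: ('a \<Rightarrow> 'k::{real_normed_field, euclidean_space}) set normed_structure) r 1"
proof -
  \<comment> \<open>One of two conjugate exponents is at least 2.\<close>
  have "2 \<le> r"
  proof (rule ccontr)
    assume "\<not> 2 \<le> r"
    then have "1 / 2 < 1 / p" "1 / 2 < 1 / q"
      using p r conjugate_exponents(1)[OF pq p] by (auto intro!: divide_strict_left_mono)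
    then show False using pq by linarith
  qed
  then show "LWP (Lp M p :: ('a \<Rightarrow> 'k) set normed_structure) r 1"
    using p r two_point_lower_1[OF pq p r] by (intro LWP_Lp_of_two_point_lower) auto
  then show "optimal_LWP (Lp M p :: ('a \<Rightarrow> 'k) set normed_structure) r 1" if "Lp_nonzero M"
    using p by (auto simp: optimal_LWP_def intro!: LWP_Lp_le_1[OF that])
qed

lemma UWP_Lp_1:
  assumes pq: "1 / p + 1 / q = 1" and p: "1 < p" and r: "1 < r" "r \<le> p" "r \<le> q"
  shows "UWP (Lp M p :: ('a \<Rightarrow> 'k::{real_normed_field, euclidean_space}) set normed_structure) r 1"
    "Lp_nonzero M \<Longrightarrow>
      optimal_UWP (Lp M p :: ('a \<Rightarrow> 'k::{real_normed_field, euclidean_space}) set normed_structure) r 1"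
proof -
  \<comment> \<open>One of two conjugate exponents is at most 2.\<close>
  have "r \<le> 2"
  proof (rule ccontr)
    assume "\<not> r \<le> 2"
    then have "1 / p < 1 / 2" "1 / q < 1 / 2"
      using p r by (auto intro!: divide_strict_left_mono)
    then show False using pq by linarith
  qed
  then show "UWP (Lp M p :: ('a \<Rightarrow> 'k) set normed_structure) r 1"
    using p r two_point_upper_1[OF pq p r] by (intro UWP_Lp_of_two_point_upper) auto
  then show "optimal_UWP (Lp M p :: ('a \<Rightarrow> 'k) set normed_structure) r 1" if "Lp_nonzero M"
    using p by (auto simp: optimal_UWP_def intro!: UWP_Lp_ge_1[OF that])
qed

lemma LWP_Lp_wp_const:
  assumes pq: "1 / p + 1 / q = 1" and p: "1 < p" "p \<le> 2" and r: "2 \<le> r" "r \<le> q"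
  shows "LWP (Lp M p :: ('a \<Rightarrow> 'k::{real_normed_field, euclidean_space}) set normed_structure) r (wp_const p r)"
    "Lp_dim_ge_2 M \<Longrightarrow>
      optimal_LWP (Lp M p :: ('a \<Rightarrow> 'k::{real_normed_field, euclidean_space}) set normed_structure) r (wp_const p r)"
proof -
  have law: "two_point_lower p r C \<longleftrightarrow> C \<le> wp_const p r" for C
    using p r by (intro two_point_lower_iff_le_wp_const) auto
  show "LWP (Lp M p :: ('a \<Rightarrow> 'k) set normed_structure) r (wp_const p r)"
    using p r law wp_const_pos[OF p r(1)] wp_const_le_1[OF pq p(1), of r]
    by (intro LWP_Lp_of_two_point_lower) auto
  then show "optimal_LWP (Lp M p :: ('a \<Rightarrow> 'k) set normed_structure) r (wp_const p r)" if "Lp_dim_ge_2 M"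
    using p by (auto simp: optimal_LWP_def law[symmetric] intro!: two_point_lower_of_LWP_Lp[OF that])
qed

text \<open>As \<open>C\<^sub>q\<^sub>,\<^sub>r\<^sub>'\<close> lies between \<open>0\<close> and \<open>1\<close>, its power \<open>- r / r'\<close> is at least \<open>1\<close>, as the passage to \<open>L\<^sup>p\<close>
  demands. The constant with exponent \<open>- p / q\<close> is a weaker one, because \<open>r / r' = r - 1 \<le> p - 1 = p / q\<close>. For
  optimality any admissible constant is dualised back to a two-point lower law for \<open>q\<close> and \<open>r'\<close>, whose best
  constant is known.\<close>

lemma UWP_Lp_wp_const:
  assumes pq: "1 / p + 1 / q = 1" and p: "2 \<le> p" and rr': "1 / r + 1 / r' = 1"
    and r: "q \<le> r" "r \<le> 2"
  shows "UWP (Lp M p :: ('a \<Rightarrow> 'k::{real_normed_field, euclidean_space}) set normed_structure) r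
      (wp_const q r' powr (- (r / r')))"
    "UWP (Lp M p :: ('a \<Rightarrow> 'k::{real_normed_field, euclidean_space}) set normed_structure) r
      (wp_const q r' powr (- (p / q)))"
    "Lp_dim_ge_2 M \<Longrightarrow>
      optimal_UWP (Lp M p :: ('a \<Rightarrow> 'k::{real_normed_field, euclidean_space}) set normed_structure) r
      (wp_const q r' powr (- (r / r')))"
proof -
  let ?L = "Lp M p :: ('a \<Rightarrow> 'k) set normed_structure"
  define c where "c = wp_const q r'"
  have p1: "1 < p" using p by simp
  note cp = conjugate_exponents[OF pq p1]
  have r1: "1 < r" using cp(1) r by simp
  note cr = conjugate_exponents[OF rr' r1]
  have qp: "1 / q + 1 / p = 1" using pq by simp
  have q: "1 < q" "q \<le> 2" using cp(1) r by auto
  have r': "2 \<le> r'" "r' \<le> p"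
    using conjugate_exponents_antimono[OF rr', of 2 2] conjugate_exponents_antimono[OF qp rr'] q r r1 by auto
  have c: "0 < c" "c \<le> 1"
    using wp_const_pos[OF q r'(1)] wp_const_le_1[OF qp q(1), of r'] r' by (auto simp: c_def)
  have law: "two_point_lower q r' C \<longleftrightarrow> C \<le> c" for C
    unfolding c_def using q r' by (intro two_point_lower_iff_le_wp_const) auto
  have c_mono: "c powr (- x) \<le> c powr (- y)" if "x \<le> y" for x y
    using c that by (intro powr_mono') auto
  have c_ge: "1 \<le> c powr (- (r / r'))"
    using c_mono[of 0 "r / r'"] c r1 cr(1) by simp
  show 1: "UWP ?L r (wp_const q r' powr (- (r / r')))"
    unfolding c_def[symmetric] using p1 r1 r p q c_ge law c
    by (intro UWP_Lp_of_two_point_upper two_point_upper_of_two_point_lower[OF pq p1 rr' r1]) auto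
  have "r / r' \<le> p / q" using cp(6) cr(6) r p by simp
  then show "UWP ?L r (wp_const q r' powr (- (p / q)))"
    using UWP_mono[OF 1] c_mono unfolding c_def by blast
  show "optimal_UWP ?L r (wp_const q r' powr (- (r / r')))" if M: "Lp_dim_ge_2 M"
    unfolding optimal_UWP_def
  proof (intro conjI allI impI 1)
    fix C assume U: "UWP ?L r C"
    have "Lp_nonzero M" using M by (auto simp: Lp_nonzero_def Lp_dim_ge_2_def)
    then have C: "1 \<le> C" using UWP_Lp_ge_1[OF _ _ U] p by simp
    have "two_point_upper p r C" using two_point_upper_of_UWP_Lp[OF M _ U] p by simp
    from two_point_lower_of_two_point_upper[OF pq p1 rr' r1 C this]
    have "C powr (- (r' / r)) \<le> c" by (simp add: law)
    then have "c powr (- (r / r')) \<le> (C powr (- (r' / r))) powr (- (r / r'))"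
      using C r1 cr(1) by (intro powr_mono2') auto
    also have "\<dots> = C" using C r1 cr(1) by (simp add: powr_powr)
    finally show "wp_const q r' powr (- (r / r')) \<le> C" by (simp add: c_def)
  qed
qed

theorem theorem1p4:
  fixes M :: "'a measure" and p q r r' :: real
    and L :: "('a \<Rightarrow> 'k::{real_normed_field, euclidean_space}) set normed_structure"
  assumes L: "L = Lp M p"
    and pq: "1 / p + 1 / q = 1"
    and rr': "1 / r + 1 / r' = 1"
  shows
    "(1 < p \<and> p \<le> 2 \<longrightarrow>
        (1 < r \<and> r \<le> p \<longrightarrow>
           UWP L r 1 \<and> (Lp_nonzero M \<longrightarrow> optimal_UWP L r 1)) \<and>
        (2 \<le> r \<and> r \<le> q \<longrightarrow>
           LWP L r (wp_const p r) \<and> (Lp_dim_ge_2 M \<longrightarrow> optimal_LWP L r (wp_const p r))) \<and>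
        (q \<le> r \<longrightarrow>
           LWP L r 1 \<and> (Lp_nonzero M \<longrightarrow> optimal_LWP L r 1))) \<and>
     (2 \<le> p \<longrightarrow>
        (p \<le> r \<longrightarrow>
           LWP L r 1 \<and> (Lp_nonzero M \<longrightarrow> optimal_LWP L r 1)) \<and>
        (q \<le> r \<and> r \<le> 2 \<longrightarrow>
           UWP L r (wp_const q r' powr (- (p / q))) \<and>
           UWP L r (wp_const q r' powr (- (r / r'))) \<and>
           (Lp_dim_ge_2 M \<longrightarrow> optimal_UWP L r (wp_const q r' powr (- (r / r'))))) \<and>
        (1 < r \<and> r \<le> q \<longrightarrow>
           UWP L r 1 \<and> (Lp_nonzero M \<longrightarrow> optimal_UWP L r 1)))"
proof -
  have two: "1 / 2 + 1 / 2 = (1 :: real)" by simp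
  have p_le_2: "2 \<le> q" if "1 < p" "p \<le> 2"
    using conjugate_exponents_antimono[OF pq two that] .
  have p_ge_2: "q \<le> 2" if "2 \<le> p"
    using conjugate_exponents_antimono[OF two pq _ that] by simp
  have U1: "UWP L r 1 \<and> (Lp_nonzero M \<longrightarrow> optimal_UWP L r 1)"
    if "1 < p" "1 < r" "r \<le> p" "r \<le> q"
    unfolding L using UWP_Lp_1[OF pq that] by blast
  have L1: "LWP L r 1 \<and> (Lp_nonzero M \<longrightarrow> optimal_LWP L r 1)"
    if "1 < p" "p \<le> r" "q \<le> r"
    unfolding L using LWP_Lp_1[OF pq that] by blast
  have LC: "LWP L r (wp_const p r) \<and> (Lp_dim_ge_2 M \<longrightarrow> optimal_LWP L r (wp_const p r))"
    if "1 < p" "p \<le> 2" "2 \<le> r" "r \<le> q"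
    unfolding L using LWP_Lp_wp_const[OF pq that] by blast
  have UC: "UWP L r (wp_const q r' powr (- (p / q))) \<and> UWP L r (wp_const q r' powr (- (r / r'))) \<and>
      (Lp_dim_ge_2 M \<longrightarrow> optimal_UWP L r (wp_const q r' powr (- (r / r'))))"
    if "2 \<le> p" "q \<le> r" "r \<le> 2"
    unfolding L using UWP_Lp_wp_const[OF pq that(1) rr' that(2,3)] by blast
  show ?thesis
  proof (cases "1 < p")
    case True
    show ?thesis
    proof (rule conjI; intro impI)
      assume "1 < p \<and> p \<le> 2"
      then have p: "1 < p" "p \<le> 2" "2 \<le> q" using p_le_2 by auto
      show "(1 < r \<and> r \<le> p \<longrightarrow> UWP L r 1 \<and> (Lp_nonzero M \<longrightarrow> optimal_UWP L r 1)) \<and>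
        (2 \<le> r \<and> r \<le> q \<longrightarrow>
           LWP L r (wp_const p r) \<and> (Lp_dim_ge_2 M \<longrightarrow> optimal_LWP L r (wp_const p r))) \<and>
        (q \<le> r \<longrightarrow> LWP L r 1 \<and> (Lp_nonzero M \<longrightarrow> optimal_LWP L r 1))"
        using p U1 L1 LC by simp
    next
      assume "2 \<le> p"
      then have p: "2 \<le> p" "1 < p" "q \<le> 2" using p_ge_2 by auto
      show "(p \<le> r \<longrightarrow> LWP L r 1 \<and> (Lp_nonzero M \<longrightarrow> optimal_LWP L r 1)) \<and>
        (q \<le> r \<and> r \<le> 2 \<longrightarrow>
           UWP L r (wp_const q r' powr (- (p / q))) \<and>
           UWP L r (wp_const q r' powr (- (r / r'))) \<and>
           (Lp_dim_ge_2 M \<longrightarrow> optimal_UWP L r (wp_const q r' powr (- (r / r'))))) \<and>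
        (1 < r \<and> r \<le> q \<longrightarrow> UWP L r 1 \<and> (Lp_nonzero M \<longrightarrow> optimal_UWP L r 1))"
        using p U1 L1 UC by simp
    qed
  qed simp
qed

end
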